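(* Consider the golf process on $\mathbb{Z}$ with parameters $\rho_b=\rho_h$ and any $p\in[0,1]$. Then almost surely the set $H^1$ of holes still free at time $1$ is empty.
   Context: Golf process on $\mathbb{Z}$: initial states i.i.d., each vertex containing a ball with probability $\rho_b$, a hole with probability $\rho_h$, neutral otherwise ($\rho_b+\rho_h\le1$); clocks i.i.d. uniform on $[0,1]$; at its clock time each ball performs an independent random walk (step $+1$ w.p. $p$, $-1$ w.p. $1-p$) started at its vertex and stopped at the first currently free hole, which it fills. (This process is almost surely well defined and not frozen when $\rho_b\le\rho_h$.) *)

theory Defs
  imports "HOL-Probability.Probability"
begin

text \<open>Golf process on the integers.
  A sample point assigns to every vertex v :: int a triple
  (initial state, clock in [0,1], step sequence of the random walk);
  step True means +1, step False means -1.\<close>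

datatype site = Ball | Hole | Neutral

definition state_pmf :: "real \<Rightarrow> real \<Rightarrow> site pmf" where
  "state_pmf rb rh = embed_pmf (\<lambda>s. case s of Ball \<Rightarrow> rb | Hole \<Rightarrow> rh | Neutral \<Rightarrow> 1 - rb - rh)"

type_synonym golf_sample = "int \<Rightarrow> site \<times> real \<times> (nat \<Rightarrow> bool)"

definition golf_measure :: "real \<Rightarrow> real \<Rightarrow> real \<Rightarrow> golf_sample measure" where
  "golf_measure rb rh p =
     PiM (UNIV :: int set) (\<lambda>_. measure_pmf (state_pmf rb rh)
        \<Otimes>\<^sub>M (uniform_measure lborel {0..1::real}
        \<Otimes>\<^sub>M PiM (UNIV :: nat set) (\<lambda>_. measure_pmf (bernoulli_pmf p))))"

definition st :: "golf_sample \<Rightarrow> int \<Rightarrow> site" where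
  "st \<omega> v = fst (\<omega> v)"

definition clock :: "golf_sample \<Rightarrow> int \<Rightarrow> real" where
  "clock \<omega> v = fst (snd (\<omega> v))"

definition walk :: "golf_sample \<Rightarrow> int \<Rightarrow> nat \<Rightarrow> int" where
  "walk \<omega> v n = v + (\<Sum>i<n. if snd (snd (\<omega> v)) i then 1 else -1)"

text \<open>An assignment T maps each ball to the hole it eventually fills (None if never).
  Hole h is free strictly before time t w.r.t. T.\<close>
definition free_before :: "golf_sample \<Rightarrow> (int \<Rightarrow> int option) \<Rightarrow> real \<Rightarrow> int \<Rightarrow> bool" where
  "free_before \<omega> T t h \<longleftrightarrow>
     st \<omega> h = Hole \<and> \<not> (\<exists>w. st \<omega> w = Ball \<and> clock \<omega> w < t \<and> T w = Some h)"

definition golf_consistent :: "golf_sample \<Rightarrow> (int \<Rightarrow> int option) \<Rightarrow> bool" where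
  "golf_consistent \<omega> T \<longleftrightarrow>
     (\<forall>v. st \<omega> v \<noteq> Ball \<longrightarrow> T v = None) \<and>
     (\<forall>v. st \<omega> v = Ball \<longrightarrow>
        T v = (if \<exists>n. free_before \<omega> T (clock \<omega> v) (walk \<omega> v n)
               then Some (walk \<omega> v (LEAST n. free_before \<omega> T (clock \<omega> v) (walk \<omega> v n)))
               else None))"

definition free_holes_at :: "golf_sample \<Rightarrow> (int \<Rightarrow> int option) \<Rightarrow> real \<Rightarrow> int set" where
  "free_holes_at \<omega> T t =
     {h. st \<omega> h = Hole \<and> \<not> (\<exists>w. st \<omega> w = Ball \<and> clock \<omega> w \<le> t \<and> T w = Some h)}"

end

theory Submission
  imports Defs
begin

text \<open>Let only the balls of a finite set \<open>A\<close> move. Adding balls can only remove free holes, so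
  the free holes of these finite systems decrease to a limit \<open>free_inf\<close>, which contains the
  free holes of every consistent assignment.

  Existence: before a time \<open>t < 1\<close> the balls are sparser than the holes. A maximal interval without
  free holes contains at least as many moved balls as holes, because nearest-neighbour walks do not
  cross free holes; as the walk counting balls minus holes has negative drift, \<open>free_inf\<close> at time
  \<open>t\<close> is unbounded on both sides. So the ball that fills a given hole starts in a finite interval
  that does not depend on \<open>A\<close>, and the finite systems converge to a consistent assignment.

  Emptiness at time 1: if only the balls of \<open>{0..<L}\<close> move, all balls between the first and the
  last free hole of \<open>{0..<L}\<close> stop there, so the number of free holes in \<open>{0..<L}\<close> is at most the
  excess of holes over balls in some subinterval. In expectation this is \<open>o(L)\<close> as the two
  densities agree, but it is at least \<open>L\<close> times the density of \<open>free_inf\<close> at time 1.\<close>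

section \<open>Finite systems and their limit\<close>

text \<open>Balls outside \<open>A\<close> become neutral while clocks and steps are kept. A finite
  system is thus again a sample, so every notion of the process applies to it, and
  \<open>A = UNIV\<close> gives the full system.\<close>

definition restr :: "int set \<Rightarrow> golf_sample \<Rightarrow> golf_sample" where
  "restr A \<omega> = (\<lambda>v. if v \<in> A \<or> st \<omega> v \<noteq> Ball then \<omega> v else (Neutral, snd (\<omega> v)))"

lemma st_restr_Ball [simp]: "st (restr A \<omega>) v = Ball \<longleftrightarrow> v \<in> A \<and> st \<omega> v = Ball"
  by (simp add: restr_def st_def)

lemma st_restr_Hole [simp]: "st (restr A \<omega>) v = Hole \<longleftrightarrow> st \<omega> v = Hole"
  by (simp add: restr_def st_def)

lemma clock_restr [simp]: "clock (restr A \<omega>) v = clock \<omega> v"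
  by (simp add: restr_def clock_def)

lemma walk_restr [simp]: "walk (restr A \<omega>) v n = walk \<omega> v n"
  by (simp add: restr_def walk_def)

lemma restr_UNIV [simp]: "restr UNIV \<omega> = \<omega>"
  by (simp add: restr_def)

text \<open>Stated as an operator, whose fixed points are the consistent assignments, the rule of
  the process can be iterated. The new target of a ball depends only on the targets of balls with
  smaller clocks.\<close>

definition golf_step :: "golf_sample \<Rightarrow> (int \<Rightarrow> int option) \<Rightarrow> int \<Rightarrow> int option" where
  "golf_step \<omega> T v =
     (if st \<omega> v = Ball \<and> (\<exists>n. free_before \<omega> T (clock \<omega> v) (walk \<omega> v n))
      then Some (walk \<omega> v (LEAST n. free_before \<omega> T (clock \<omega> v) (walk \<omega> v n)))
      else None)"

lemma golf_consistent_iff_step: "golf_consistent \<omega> T \<longleftrightarrow> (\<forall>v. T v = golf_step \<omega> T v)"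
  unfolding golf_consistent_def golf_step_def by (intro iffI allI conjI impI) (auto split: if_splits)

lemma golf_consistentD:
  assumes "golf_consistent \<omega> T" "T v = Some h"
  obtains n where "st \<omega> v = Ball" "h = walk \<omega> v n" "free_before \<omega> T (clock \<omega> v) h"
    "\<And>i. i < n \<Longrightarrow> \<not> free_before \<omega> T (clock \<omega> v) (walk \<omega> v i)"
proof -
  let ?P = "\<lambda>n. free_before \<omega> T (clock \<omega> v) (walk \<omega> v n)"
  have "golf_step \<omega> T v = Some h"
    using assms by (simp add: golf_consistent_iff_step)
  hence *: "st \<omega> v = Ball" "\<exists>n. ?P n" "h = walk \<omega> v (LEAST n. ?P n)"
    by (auto simp: golf_step_def split: if_splits)
  show ?thesis
    using that[OF *(1,3)] LeastI_ex[OF *(2)] not_less_Least[of _ ?P] *(3) by blast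
qed

lemma golf_consistentI_first:
  assumes "golf_consistent \<omega> T" "st \<omega> v = Ball" "free_before \<omega> T (clock \<omega> v) (walk \<omega> v n)"
    "\<And>i. i < n \<Longrightarrow> \<not> free_before \<omega> T (clock \<omega> v) (walk \<omega> v i)"
  shows "T v = Some (walk \<omega> v n)"
proof -
  have "(LEAST n. free_before \<omega> T (clock \<omega> v) (walk \<omega> v n)) = n"
    using assms(3,4) by (intro Least_equality) (auto simp: not_less[symmetric])
  thus ?thesis using assms unfolding golf_consistent_def by auto
qed

lemma free_before_antimono_time:
  "free_before \<omega> T t h \<Longrightarrow> s \<le> t \<Longrightarrow> free_before \<omega> T s h"
  unfolding free_before_def by force

text \<open>Induction on the clock of a ball that would violate the inclusion: only finitely many balls
  move in the smaller system, so there is an earliest one.\<close>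

lemma free_before_restr_mono:
  assumes T: "golf_consistent (restr A \<omega>) T" and T': "golf_consistent (restr B \<omega>) T'"
    and AB: "A \<subseteq> B" and fin: "finite A"
    and "free_before (restr B \<omega>) T' t h"
  shows "free_before (restr A \<omega>) T t h"
proof -
  have *: "T w \<noteq> Some h"
    if "free_before (restr B \<omega>) T' t h" "w \<in> A" "clock \<omega> w < t" for w t h
    using that
  proof (induction "card {u\<in>A. clock \<omega> u < clock \<omega> w}" arbitrary: w t h rule: less_induct)
    case less
    show ?case
    proof
      assume "T w = Some h"
      then obtain n where n: "st (restr A \<omega>) w = Ball" "h = walk \<omega> w n"
        "\<And>i. i < n \<Longrightarrow> \<not> free_before (restr A \<omega>) T (clock \<omega> w) (walk \<omega> w i)"
        using golf_consistentD[OF T] by (metis clock_restr walk_restr)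
      \<comment> \<open>By the induction hypothesis, a site free in the larger system at the clock
        of \<open>w\<close> is free in the smaller one. The walk of \<open>w\<close> meets no free
        hole of the smaller system before \<open>h\<close>, so in the larger system it also stops at
        \<open>h\<close>, although \<open>h\<close> should still be free there.\<close>
      have mono: "free_before (restr A \<omega>) T (clock \<omega> w) x"
        if "free_before (restr B \<omega>) T' (clock \<omega> w) x" for x
      proof -
        have "T u \<noteq> Some x" if u: "u \<in> A" "clock \<omega> u < clock \<omega> w" for u
        proof (rule less.hyps[OF _ \<open>free_before (restr B \<omega>) T' (clock \<omega> w) x\<close> u])
          show "card {v \<in> A. clock \<omega> v < clock \<omega> u} < card {v \<in> A. clock \<omega> v < clock \<omega> w}"
            using u fin by (intro psubset_card_mono) auto
        qed
        thus ?thesis using that by (auto simp: free_before_def)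
      qed
      have "free_before (restr B \<omega>) T' (clock \<omega> w) h"
        using less.prems by (auto intro: free_before_antimono_time)
      hence "T' w = Some h"
        using golf_consistentI_first[OF T', of w n] n mono AB less.prems(2) by auto
      thus False using less.prems AB n(1) by (auto simp: free_before_def)
    qed
  qed
  show ?thesis using *[OF assms(5)] assms(5) by (auto simp: free_before_def)
qed

definition golf_iter :: "nat \<Rightarrow> golf_sample \<Rightarrow> int \<Rightarrow> int option" where
  "golf_iter k \<omega> = (golf_step \<omega> ^^ k) (\<lambda>_. None)"

definition golf_fin :: "int set \<Rightarrow> golf_sample \<Rightarrow> int \<Rightarrow> int option" where
  "golf_fin A \<omega> = golf_iter (card A) (restr A \<omega>)"

text \<open>After \<open>k\<close> iterations the targets of the first \<open>k\<close> balls, in the order of their clocks,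
  are final.\<close>

lemma golf_fin_consistent:
  assumes "finite A"
  shows "golf_consistent (restr A \<omega>) (golf_fin A \<omega>)"
proof -
  define \<omega>' where "\<omega>' = restr A \<omega>"
  \<comment> \<open>The rank of \<open>v\<close> in the order of the clocks. Ties do no harm, since
    \<open>free_before\<close> looks only at strictly smaller clocks.\<close>
  define r where "r v = card {u\<in>A. clock \<omega>' u < clock \<omega>' v}" for v
  have ball: "v \<in> A" if "st \<omega>' v = Ball" for v
    using that by (simp add: \<omega>'_def)
  have *: "golf_iter (Suc k) \<omega>' v = golf_iter k \<omega>' v" if "st \<omega>' v = Ball" "r v < k" for k v
    using that
  proof (induction k arbitrary: v)
    case (Suc k)
    have "golf_iter (Suc k) \<omega>' w = golf_iter k \<omega>' w"
      if "st \<omega>' w = Ball" "clock \<omega>' w < clock \<omega>' v" for w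
    proof (rule Suc.IH)
      have "r w < r v"
        unfolding r_def using that assms ball by (intro psubset_card_mono) auto
      thus "r w < k" using Suc.prems by simp
    qed (fact that)
    hence "free_before \<omega>' (golf_iter (Suc k) \<omega>') (clock \<omega>' v) =
           free_before \<omega>' (golf_iter k \<omega>') (clock \<omega>' v)"
      by (auto simp: free_before_def fun_eq_iff)
    hence "golf_step \<omega>' (golf_iter (Suc k) \<omega>') v = golf_step \<omega>' (golf_iter k \<omega>') v"
      by (simp add: golf_step_def)
    thus ?case by (simp add: golf_iter_def)
  qed simp
  have "golf_step \<omega>' (golf_iter (card A) \<omega>') v = golf_iter (card A) \<omega>' v" for v
  proof (cases "st \<omega>' v = Ball")
    case True
    have "r v < card A"
      unfolding r_def using assms ball[OF True] by (intro psubset_card_mono) auto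
    from *[OF True this] show ?thesis by (simp add: golf_iter_def)
  next
    case False
    thus ?thesis by (cases "card A") (simp_all add: golf_iter_def golf_step_def)
  qed
  thus ?thesis by (simp add: golf_consistent_iff_step golf_fin_def \<omega>'_def)
qed

definition free_fin :: "int set \<Rightarrow> golf_sample \<Rightarrow> real \<Rightarrow> int set" where
  "free_fin A \<omega> t = {h. free_before (restr A \<omega>) (golf_fin A \<omega>) t h}"

lemma golf_finD:
  assumes "finite A" "golf_fin A \<omega> w = Some h"
  obtains n where "w \<in> A" "st \<omega> w = Ball" "h = walk \<omega> w n" "h \<in> free_fin A \<omega> (clock \<omega> w)"
    "\<And>i. i < n \<Longrightarrow> walk \<omega> w i \<notin> free_fin A \<omega> (clock \<omega> w)"
proof -
  obtain n where "st (restr A \<omega>) w = Ball" "h = walk (restr A \<omega>) w n"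
    "free_before (restr A \<omega>) (golf_fin A \<omega>) (clock (restr A \<omega>) w) h"
    "\<And>i. i < n \<Longrightarrow> \<not> free_before (restr A \<omega>) (golf_fin A \<omega>) (clock (restr A \<omega>) w) (walk (restr A \<omega>) w i)"
    using golf_consistentD[OF golf_fin_consistent[OF assms(1)] assms(2)] by metis
  thus ?thesis by (intro that[of n]) (simp_all add: free_fin_def)
qed

lemma golf_finI:
  assumes "finite A" "w \<in> A" "st \<omega> w = Ball" "walk \<omega> w n \<in> free_fin A \<omega> (clock \<omega> w)"
    "\<And>i. i < n \<Longrightarrow> walk \<omega> w i \<notin> free_fin A \<omega> (clock \<omega> w)"
  shows "golf_fin A \<omega> w = Some (walk \<omega> w n)"
proof -
  have "golf_fin A \<omega> w = Some (walk (restr A \<omega>) w n)"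
    using assms(2-5)
    by (intro golf_consistentI_first[OF golf_fin_consistent[OF assms(1)]])
       (simp_all only: free_fin_def mem_Collect_eq clock_restr walk_restr st_restr_Ball simp_thms)
  thus ?thesis by simp
qed

lemma mem_free_fin_iff:
  "finite A \<Longrightarrow> h \<in> free_fin A \<omega> t \<longleftrightarrow>
     st \<omega> h = Hole \<and> (\<forall>w. clock \<omega> w < t \<longrightarrow> golf_fin A \<omega> w \<noteq> Some h)"
  unfolding free_fin_def free_before_def using golf_finD[of A \<omega> _ h]
  by (simp only: mem_Collect_eq st_restr_Hole st_restr_Ball clock_restr) blast

text \<open>This is defined for every sample, even where no consistent assignment exists. By
  monotonicity in \<open>A\<close> the intersection is a decreasing limit.\<close>

definition free_inf :: "golf_sample \<Rightarrow> real \<Rightarrow> int set" where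
  "free_inf \<omega> t = (\<Inter>A\<in>{A. finite A}. free_fin A \<omega> t)"

lemma free_fin_mono: "finite B \<Longrightarrow> A \<subseteq> B \<Longrightarrow> free_fin B \<omega> t \<subseteq> free_fin A \<omega> t"
  unfolding free_fin_def
  using free_before_restr_mono[of A \<omega> "golf_fin A \<omega>" B "golf_fin B \<omega>"] golf_fin_consistent
  by (auto dest: finite_subset)

lemma free_fin_antimono_time: "s \<le> t \<Longrightarrow> free_fin A \<omega> t \<subseteq> free_fin A \<omega> s"
  unfolding free_fin_def using free_before_antimono_time by blast

lemma free_inf_antimono_time: "s \<le> t \<Longrightarrow> free_inf \<omega> t \<subseteq> free_inf \<omega> s"
  unfolding free_inf_def by (rule INF_superset_mono) (simp_all add: free_fin_antimono_time)

lemma finite_int_subset_box: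
  assumes "finite (A::int set)" obtains N :: nat where "A \<subseteq> {-int N..int N}"
proof
  show "A \<subseteq> {-int (Max (insert 0 ((\<lambda>x. nat \<bar>x\<bar>) ` A)))..int (Max (insert 0 ((\<lambda>x. nat \<bar>x\<bar>) ` A)))}"
  proof
    fix x assume "x \<in> A"
    hence "nat \<bar>x\<bar> \<le> Max (insert 0 ((\<lambda>x. nat \<bar>x\<bar>) ` A))"
      using assms by (intro Max_ge) auto
    thus "x \<in> {-int (Max (insert 0 ((\<lambda>x. nat \<bar>x\<bar>) ` A)))..int (Max (insert 0 ((\<lambda>x. nat \<bar>x\<bar>) ` A)))}"
      by auto
  qed
qed

text \<open>Boxes turn the intersection into a countable one, which gives measurability, and into a
  monotone one, so that a site outside \<open>free_inf\<close> is not free in any sufficiently large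
  box.\<close>

lemma free_inf_eq_boxes: "free_inf \<omega> t = (\<Inter>N. free_fin {-int N..int N} \<omega> t)"
proof
  show "free_inf \<omega> t \<subseteq> (\<Inter>N. free_fin {-int N..int N} \<omega> t)"
    unfolding free_inf_def by auto
  have "(\<Inter>N. free_fin {-int N..int N} \<omega> t) \<subseteq> free_fin A \<omega> t" if A: "finite A" for A
  proof -
    obtain N where "A \<subseteq> {-int N..int N}" using finite_int_subset_box[OF A] .
    hence "free_fin {-int N..int N} \<omega> t \<subseteq> free_fin A \<omega> t" by (intro free_fin_mono) auto
    thus ?thesis by blast
  qed
  thus "(\<Inter>N. free_fin {-int N..int N} \<omega> t) \<subseteq> free_inf \<omega> t"
    unfolding free_inf_def by auto
qed

lemma not_free_inf_box:
  assumes "h \<notin> free_inf \<omega> t"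
  obtains N0 where "\<And>N. N \<ge> N0 \<Longrightarrow> h \<notin> free_fin {-int N..int N} \<omega> t"
proof -
  obtain N0 where N0: "h \<notin> free_fin {-int N0..int N0} \<omega> t"
    using assms by (auto simp: free_inf_eq_boxes)
  show ?thesis
  proof (rule that)
    fix N assume "N0 \<le> N"
    hence "{-int N0..int N0} \<subseteq> {-int N..int N}" by auto
    from free_fin_mono[OF _ this] N0 show "h \<notin> free_fin {-int N..int N} \<omega> t" by auto
  qed
qed

text \<open>The full system is the case \<open>B = UNIV\<close> of
  \<open>free_before_restr_mono\<close>. Hence emptiness of \<open>free_inf\<close> settles all
  consistent assignments at once, and their uniqueness need not be discussed.\<close>

lemma free_holes_at_subset_free_inf:
  assumes "golf_consistent \<omega> T" "\<And>v. clock \<omega> v \<noteq> t"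
  shows "free_holes_at \<omega> T t \<subseteq> free_inf \<omega> t"
proof
  fix h assume "h \<in> free_holes_at \<omega> T t"
  hence "free_before \<omega> T t h" by (auto simp: free_holes_at_def free_before_def)
  hence "h \<in> free_fin A \<omega> t" if "finite A" for A
    using free_before_restr_mono[of A \<omega> "golf_fin A \<omega>" UNIV T t h] golf_fin_consistent that assms(1)
    by (simp add: free_fin_def)
  thus "h \<in> free_inf \<omega> t" by (simp add: free_inf_def)
qed

section \<open>Nearest-neighbour walks do not cross free holes\<close>

lemma walk_0 [simp]: "walk \<omega> v 0 = v"
  by (simp add: walk_def)

lemma walk_Suc: "walk \<omega> v (Suc n) = walk \<omega> v n + 1 \<or> walk \<omega> v (Suc n) = walk \<omega> v n - 1"
  by (simp add: walk_def)

text \<open>Steps of size one cannot jump over \<open>x\<close>. The inequalities are weak because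
  the walk may stand on \<open>x\<close> at time \<open>n\<close> itself.\<close>

lemma walk_confined:
  assumes "\<And>i. i < n \<Longrightarrow> walk \<omega> v i \<noteq> x"
  shows "v < x \<Longrightarrow> walk \<omega> v n \<le> x" "v > x \<Longrightarrow> walk \<omega> v n \<ge> x"
  using assms
proof (induction n)
  case (Suc n)
  { case 1
    hence "walk \<omega> v n \<le> x" "walk \<omega> v n \<noteq> x" using Suc.IH(1) by auto
    thus ?case using walk_Suc[of \<omega> v n] by auto
  next
    case 2
    hence "walk \<omega> v n \<ge> x" "walk \<omega> v n \<noteq> x" using Suc.IH(2) by auto
    thus ?case using walk_Suc[of \<omega> v n] by auto }
qed simp_all

lemma target_beyond_free_hole:
  assumes "golf_consistent \<omega> T" "T v = Some h" "free_before \<omega> T (clock \<omega> v) x"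
  shows "v < x \<Longrightarrow> h \<le> x" "v > x \<Longrightarrow> h \<ge> x"
proof -
  obtain n where n: "h = walk \<omega> v n"
    "\<And>i. i < n \<Longrightarrow> \<not> free_before \<omega> T (clock \<omega> v) (walk \<omega> v i)"
    using golf_consistentD[OF assms(1,2)] by metis
  hence "walk \<omega> v i \<noteq> x" if "i < n" for i using assms(3) that by auto
  thus "v < x \<Longrightarrow> h \<le> x" "v > x \<Longrightarrow> h \<ge> x"
    using walk_confined[of n \<omega> v x] n(1) by auto
qed

text \<open>A ball from outside would have to step on an end point that is free at \<open>t\<close>,
  hence also at the earlier clock of the ball, and would stop there. The alternative that no ball
  lies beyond an end point serves intervals that reach past the last ball of a finite
  system.\<close>

lemma filler_between_free_holes:
  assumes T: "golf_consistent \<omega> T" "T v = Some h" "clock \<omega> v < t"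
    and h: "a < h" "h < b"
    and a: "free_before \<omega> T t a \<or> (\<forall>w\<le>a. st \<omega> w \<noteq> Ball)"
    and b: "free_before \<omega> T t b \<or> (\<forall>w\<ge>b. st \<omega> w \<noteq> Ball)"
  shows "a < v" "v < b"
proof -
  have ball: "st \<omega> v = Ball" using T by (auto simp: golf_consistent_def)
  show "a < v"
  proof (rule ccontr)
    assume "\<not> a < v"
    hence v: "v \<le> a" by simp
    hence fa: "free_before \<omega> T t a" using a ball by auto
    hence "v \<noteq> a" using ball by (auto simp: free_before_def)
    moreover have "free_before \<omega> T (clock \<omega> v) a"
      using fa T(3) by (auto intro: free_before_antimono_time)
    ultimately show False
      using target_beyond_free_hole(1)[OF T(1,2)] v h by fastforce
  qed
  show "v < b"
  proof (rule ccontr)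
    assume "\<not> v < b"
    hence v: "v \<ge> b" by simp
    hence fb: "free_before \<omega> T t b" using b ball by auto
    hence "v \<noteq> b" using ball by (auto simp: free_before_def)
    moreover have "free_before \<omega> T (clock \<omega> v) b"
      using fb T(3) by (auto intro: free_before_antimono_time)
    ultimately show False
      using target_beyond_free_hole(2)[OF T(1,2)] v h by fastforce
  qed
qed

section \<open>Existence of the infinite system\<close>

text \<open>The free holes on both sides of \<open>h\<close> confine the ball that fills \<open>h\<close> to finitely many
  starting points, uniformly in the size of the box; without this the filling balls could escape to
  infinity in the limit.\<close>

lemma golf_consistent_exists:
  assumes clock: "\<And>v. clock \<omega> v < 1"
    and free: "\<And>s h. s < 1 \<Longrightarrow> st \<omega> h = Hole \<Longrightarrow>
      (\<exists>a<h. a \<in> free_inf \<omega> s) \<and> (\<exists>b>h. b \<in> free_inf \<omega> s)"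
  shows "\<exists>T. golf_consistent \<omega> T"
proof -
  let ?F = "\<lambda>v n. walk \<omega> v n \<in> free_inf \<omega> (clock \<omega> v)"
  let ?box = "\<lambda>N. {-int N..int N}"
  define T where "T v = (if st \<omega> v = Ball \<and> (\<exists>n. ?F v n)
    then Some (walk \<omega> v (LEAST n. ?F v n)) else None)" for v
  \<comment> \<open>This claim makes \<open>T\<close> consistent: \<open>T\<close> sends each ball
    to the first site of its walk lying in \<open>free_inf\<close> at its clock, and this is the
    rule of the process once freeness with respect to \<open>T\<close> is membership in
    \<open>free_inf\<close>.\<close>
  have eq: "free_before \<omega> T s h \<longleftrightarrow> h \<in> free_inf \<omega> s" if s: "s < 1" for s h
  proof
    assume h: "h \<in> free_inf \<omega> s"
    hence hole: "st \<omega> h = Hole"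
      unfolding free_inf_def free_fin_def by (auto simp: free_before_def)
    have False if w: "st \<omega> w = Ball" "clock \<omega> w < s" "T w = Some h" for w
    proof -
      define n where "n = (LEAST n. ?F w n)"
      have ex: "\<exists>n. ?F w n" and hn: "h = walk \<omega> w n"
        using w(3) by (auto simp: T_def n_def split: if_splits)
      have "\<forall>i\<in>{..<n}. \<exists>N0. \<forall>N\<ge>N0. walk \<omega> w i \<notin> free_fin (?box N) \<omega> (clock \<omega> w)"
      proof
        fix i assume "i \<in> {..<n}"
        hence "\<not> ?F w i" using not_less_Least[of i "?F w"] by (simp add: n_def)
        thus "\<exists>N0. \<forall>N\<ge>N0. walk \<omega> w i \<notin> free_fin (?box N) \<omega> (clock \<omega> w)"
          using not_free_inf_box by metis
      qed
      then obtain N0 where N0: "\<And>i N. i < n \<Longrightarrow> N \<ge> N0 i \<Longrightarrow>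
          walk \<omega> w i \<notin> free_fin (?box N) \<omega> (clock \<omega> w)"
        by (metis lessThan_iff)
      \<comment> \<open>A box that contains \<open>w\<close> and exceeds all thresholds
        \<open>N0 i\<close>, so that \<open>w\<close> stops in it at the same site as under
        \<open>T\<close>.\<close>
      define N where "N = nat \<bar>w\<bar> + (\<Sum>i<n. N0 i)"
      have N: "N \<ge> N0 i" if "i < n" for i
        unfolding N_def using that member_le_sum[of i "{..<n}" N0] by auto
      have "nat \<bar>w\<bar> \<le> N" by (simp add: N_def)
      hence "w \<in> ?box N" by auto
      have "golf_fin (?box N) \<omega> w = Some (walk \<omega> w n)"
      proof (rule golf_finI)
        show "walk \<omega> w n \<in> free_fin (?box N) \<omega> (clock \<omega> w)"
          using h free_fin_antimono_time[of "clock \<omega> w" s] w(2) by (auto simp: free_inf_def hn[symmetric])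
        show "walk \<omega> w i \<notin> free_fin (?box N) \<omega> (clock \<omega> w)" if "i < n" for i
          using N0[OF that N[OF that]] .
      qed (use w \<open>w \<in> ?box N\<close> in simp_all)
      moreover have "h \<in> free_fin (?box N) \<omega> s" using h by (auto simp: free_inf_def)
      ultimately show False
        using w hn by (auto simp: mem_free_fin_iff)
    qed
    thus "free_before \<omega> T s h" using hole by (auto simp: free_before_def)
  next
    assume fb: "free_before \<omega> T s h"
    hence hole: "st \<omega> h = Hole" by (simp add: free_before_def)
    show "h \<in> free_inf \<omega> s"
    proof (rule ccontr)
      assume "h \<notin> free_inf \<omega> s"
      then obtain N0 where N0: "\<And>N. N \<ge> N0 \<Longrightarrow> h \<notin> free_fin (?box N) \<omega> s"
        using not_free_inf_box by metis
      obtain a b where ab: "a < h" "h < b" "a \<in> free_inf \<omega> s" "b \<in> free_inf \<omega> s"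
        using free[OF s hole] by blast
      have "\<exists>w. w \<in> {a<..<b} \<and> st \<omega> w = Ball \<and> clock \<omega> w < s \<and> golf_fin (?box (N0+N)) \<omega> w = Some h"
        for N
      proof -
        let ?B = "?box (N0+N)"
        have "h \<notin> free_fin ?B \<omega> s" by (rule N0) simp
        then obtain w where w: "clock \<omega> w < s" "golf_fin ?B \<omega> w = Some h"
          using hole by (auto simp: mem_free_fin_iff)
        moreover have "st \<omega> w = Ball" using golf_finD[OF _ w(2)] by auto
        moreover note ab
        moreover have "a < w" "w < b"
          using filler_between_free_holes[OF golf_fin_consistent[of ?B \<omega>] w(2), of s a b] w ab
          by (auto simp: free_inf_def free_fin_def)
        ultimately show ?thesis by auto
      qed
      then obtain f where f: "\<And>N. f N \<in> {a<..<b} \<and> st \<omega> (f N) = Ball \<and> clock \<omega> (f N) < s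
          \<and> golf_fin (?box (N0+N)) \<omega> (f N) = Some h"
        by metis
      \<comment> \<open>The ball that fills \<open>h\<close> may change with the box, but only
        finitely many starting points are possible, so one ball \<open>w\<close> fills
        \<open>h\<close> in infinitely many boxes.\<close>
      have "finite (range f)" using f by (intro finite_subset[of "range f" "{a<..<b}"]) blast+
      then obtain N1 where inf: "infinite {N. f N = f N1}"
        using pigeonhole_infinite[of "UNIV::nat set" f] by (auto simp: infinite_UNIV_nat)
      define w where "w = f N1"
      have w: "st \<omega> w = Ball" "clock \<omega> w < s" using f[of N1] unfolding w_def by blast+
      have often: "\<exists>N'\<ge>N. golf_fin (?box N') \<omega> w = Some h" for N
      proof -
        obtain N' where "N' \<ge> N" "f N' = w"
          using inf unfolding infinite_nat_iff_unbounded_le w_def by auto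
        thus ?thesis using f[of N'] by (metis trans_le_add2)
      qed
      have hfree: "h \<in> free_inf \<omega> (clock \<omega> w)"
      proof (rule ccontr)
        assume "h \<notin> free_inf \<omega> (clock \<omega> w)"
        then obtain N2 where "\<And>N. N \<ge> N2 \<Longrightarrow> h \<notin> free_fin (?box N) \<omega> (clock \<omega> w)"
          using not_free_inf_box by metis
        moreover obtain N' where "N' \<ge> N2" "golf_fin (?box N') \<omega> w = Some h"
          using often by blast
        moreover have "h \<in> free_fin (?box N') \<omega> (clock \<omega> w)"
          using golf_finD[OF _ \<open>golf_fin (?box N') \<omega> w = Some h\<close>] by auto
        ultimately show False by blast
      qed
      have ex: "\<exists>n. walk \<omega> w n = h"
        using often[of 0] by (auto elim!: golf_finD[rotated])
      \<comment> \<open>The first visit to \<open>h\<close>. In a box where \<open>w\<close> fills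
        \<open>h\<close> it stops at time \<open>n\<close> or later, so the sites visited before
        time \<open>n\<close> are not free in that box and a fortiori not in
        \<open>free_inf\<close>.\<close>
      define n where "n = (LEAST n. walk \<omega> w n = h)"
      have n: "walk \<omega> w n = h" unfolding n_def using ex by (rule LeastI_ex)
      have "\<not> ?F w i" if i: "i < n" for i
      proof
        assume Fi: "?F w i"
        obtain N' where N': "golf_fin (?box N') \<omega> w = Some h" using often by blast
        then obtain m where m: "h = walk \<omega> w m"
          "\<And>i. i < m \<Longrightarrow> walk \<omega> w i \<notin> free_fin (?box N') \<omega> (clock \<omega> w)"
          using golf_finD[OF _ N'] by (metis finite_atLeastAtMost_int)
        have "n \<le> m" unfolding n_def using m(1) by (intro Least_le) simp
        hence "walk \<omega> w i \<notin> free_fin (?box N') \<omega> (clock \<omega> w)" using m(2) i by simp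
        thus False using Fi by (auto simp: free_inf_def)
      qed
      moreover have "?F w n" using n hfree by simp
      ultimately have "(LEAST n. ?F w n) = n"
        by (intro Least_equality) (auto simp: not_less[symmetric])
      hence "T w = Some h" using w n \<open>?F w n\<close> by (auto simp: T_def)
      thus False using fb w by (auto simp: free_before_def)
    qed
  qed
  have "golf_consistent \<omega> T"
    unfolding golf_consistent_iff_step golf_step_def eq[OF clock] by (simp add: T_def)
  thus ?thesis by blast
qed

section \<open>Counting balls and holes\<close>

definition gain :: "real \<Rightarrow> golf_sample \<Rightarrow> int \<Rightarrow> real" where
  "gain t \<omega> v = (if st \<omega> v = Ball \<and> clock \<omega> v < t then 1 else if st \<omega> v = Hole then -1 else 0)"

lemma sum_gain:
  assumes "finite I"
  shows "(\<Sum>v\<in>I. gain t \<omega> v) =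
    real (card {v\<in>I. st \<omega> v = Ball \<and> clock \<omega> v < t}) - real (card {v\<in>I. st \<omega> v = Hole})"
proof -
  have "(\<Sum>v\<in>I. gain t \<omega> v) =
    (\<Sum>v\<in>I. (if st \<omega> v = Ball \<and> clock \<omega> v < t then 1 else 0) - (if st \<omega> v = Hole then 1 else 0))"
    by (intro sum.cong) (auto simp: gain_def)
  also have "\<dots> = (\<Sum>v\<in>I. if st \<omega> v = Ball \<and> clock \<omega> v < t then 1 else 0) -
    (\<Sum>v\<in>I. if st \<omega> v = Hole then 1 else 0)"
    by (rule sum_subtractf)
  finally show ?thesis
    using assms by (simp add: sum.If_cases Collect_conj_eq Int_commute Int_left_commute Int_assoc)
qed

text \<open>In a maximal interval without free holes, every hole has been filled from within.\<close>

lemma free_fin_meets_interval: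
  assumes fin: "finite A" and le: "lo \<le> hi + 1"
    and neg: "\<And>a b. a \<le> lo \<Longrightarrow> b \<ge> hi \<Longrightarrow> (\<Sum>v=a..b. gain t \<omega> v) < 0"
  shows "\<exists>h\<in>{lo..hi}. h \<in> free_fin A \<omega> t"
proof (rule ccontr)
  assume none: "\<not> ?thesis"
  let ?\<omega> = "restr A \<omega>"
  let ?T = "golf_fin A \<omega>"
  obtain N where N: "A \<subseteq> {-int N..int N}" using finite_int_subset_box[OF fin] .
  \<comment> \<open>\<open>P\<close> and \<open>Q\<close> are the barriers allowed by
    \<open>filler_between_free_holes\<close>. As \<open>A\<close> lies in a box, \<open>a0\<close>
    and \<open>b0\<close> are barriers; \<open>a\<close> and \<open>b\<close> will be the barriers
    nearest to the interval on its two sides.\<close>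
  define P where "P a \<longleftrightarrow> a \<in> free_fin A \<omega> t \<or> (\<forall>w\<le>a. st ?\<omega> w \<noteq> Ball)" for a
  define Q where "Q b \<longleftrightarrow> b \<in> free_fin A \<omega> t \<or> (\<forall>w\<ge>b. st ?\<omega> w \<noteq> Ball)" for b
  define a0 where "a0 = min (lo - 1) (- int N - 1)"
  define b0 where "b0 = max (hi + 1) (int N + 1)"
  define SP where "SP = {x\<in>{a0..lo-1}. P x}"
  define SQ where "SQ = {x\<in>{hi+1..b0}. Q x}"
  have finS: "finite SP" "finite SQ"
    by (rule finite_subset[of _ "{a0..lo-1}"], auto simp: SP_def)
       (rule finite_subset[of _ "{hi+1..b0}"], auto simp: SQ_def)
  have "P a0" "Q b0" using N by (force simp: P_def a0_def Q_def b0_def)+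
  hence "a0 \<in> SP" "b0 \<in> SQ" by (simp_all add: SP_def a0_def SQ_def b0_def)
  hence neS: "SP \<noteq> {}" "SQ \<noteq> {}" by blast+
  define a where "a = Max SP"
  define b where "b = Min SQ"
  have "a \<in> SP" "b \<in> SQ" unfolding a_def b_def using finS neS by (auto intro: Max_in Min_in)
  hence a: "a \<ge> a0" "a < lo" "P a" and b: "b \<le> b0" "hi < b" "Q b" by (auto simp: SP_def SQ_def)
  have a_max: "\<not> P x" if "a < x" "x < lo" for x
    using Max_ge[OF finS(1), of x] that a(1) by (auto simp: a_def SP_def)
  have b_min: "\<not> Q x" if "hi < x" "x < b" for x
    using Min_le[OF finS(2), of x] that b(1) by (auto simp: b_def SQ_def)
  have nofree: "h \<notin> free_fin A \<omega> t" if "a < h" "h < b" for h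
    using a_max[of h] b_min[of h] none that by (cases "h < lo"; cases "h > hi") (auto simp: P_def Q_def)
  \<comment> \<open>The targets of the balls moved between \<open>a\<close> and \<open>b\<close>
    cover all holes there, so the holes do not outnumber these balls. This contradicts
    \<open>neg\<close>, as \<open>{a+1..b-1}\<close> contains \<open>{lo..hi}\<close>.\<close>
  have "{v\<in>{a+1..b-1}. st \<omega> v = Hole} \<subseteq>
    (\<lambda>w. the (?T w)) ` {v\<in>{a+1..b-1}. st \<omega> v = Ball \<and> clock \<omega> v < t}"
  proof
    fix h assume h: "h \<in> {v\<in>{a+1..b-1}. st \<omega> v = Hole}"
    hence "h \<notin> free_fin A \<omega> t" using nofree by auto
    then obtain w where w: "clock \<omega> w < t" "?T w = Some h"
      using h fin by (auto simp: mem_free_fin_iff)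
    have "a < w" "w < b"
      using filler_between_free_holes[OF golf_fin_consistent[OF fin] w(2), of t a b] w(1) h a(3) b(3)
      by (auto simp: P_def Q_def free_fin_def)
    thus "h \<in> (\<lambda>w. the (?T w)) ` {v\<in>{a+1..b-1}. st \<omega> v = Ball \<and> clock \<omega> v < t}"
      using w golf_finD[OF fin w(2)] by (intro image_eqI[of _ _ w]) auto
  qed
  hence "card {v\<in>{a+1..b-1}. st \<omega> v = Hole} \<le>
    card {v\<in>{a+1..b-1}. st \<omega> v = Ball \<and> clock \<omega> v < t}"
    by (rule surj_card_le[rotated]) (rule finite_subset[of _ "{a+1..b-1}"], auto)
  hence "(\<Sum>v=a+1..b-1. gain t \<omega> v) \<ge> 0" by (simp add: sum_gain)
  moreover have "(\<Sum>v=a+1..b-1. gain t \<omega> v) < 0" using a b by (intro neg) auto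
  ultimately show False by simp
qed

text \<open>A compactness argument: if every site of the finite interval dropped out of
  \<open>free_inf\<close>, one large box would already have none of them free.\<close>

lemma free_inf_meets_interval:
  assumes "lo \<le> hi + 1"
    and "\<And>a b. a \<le> lo \<Longrightarrow> b \<ge> hi \<Longrightarrow> (\<Sum>v=a..b. gain t \<omega> v) < 0"
  shows "\<exists>h\<in>{lo..hi}. h \<in> free_inf \<omega> t"
proof (rule ccontr)
  assume "\<not> ?thesis"
  hence "\<forall>h\<in>{lo..hi}. \<exists>N0. \<forall>N\<ge>N0. h \<notin> free_fin {-int N..int N} \<omega> t"
    using not_free_inf_box by metis
  then obtain N0 where N0: "\<And>h N. h \<in> {lo..hi} \<Longrightarrow> N \<ge> N0 h \<Longrightarrow> h \<notin> free_fin {-int N..int N} \<omega> t"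
    by metis
  define N where "N = (\<Sum>h\<in>{lo..hi}. N0 h)"
  have "N \<ge> N0 h" if "h \<in> {lo..hi}" for h
    unfolding N_def using that by (intro member_le_sum) auto
  hence "h \<notin> free_fin {-int N..int N} \<omega> t" if "h \<in> {lo..hi}" for h
    using N0 that by auto
  moreover have "\<exists>h\<in>{lo..hi}. h \<in> free_fin {-int N..int N} \<omega> t"
    using assms by (intro free_fin_meets_interval) auto
  ultimately show False by blast
qed

lemma at_bot_bounded_above:
  fixes f :: "nat \<Rightarrow> real"
  assumes "filterlim f at_bot sequentially"
  obtains C where "\<And>n. f n \<le> C"
proof -
  have "eventually (\<lambda>n. f n \<le> 0) sequentially" using assms unfolding filterlim_at_bot by blast
  then obtain N where N: "\<And>n. n \<ge> N \<Longrightarrow> f n \<le> 0" unfolding eventually_sequentially by blast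
  have "f n \<le> Max (insert 0 (f ` {..<N}))" for n
  proof (cases "n < N")
    case False
    hence "f n \<le> 0" using N by simp
    also have "0 \<le> Max (insert 0 (f ` {..<N}))" by (intro Max_ge) auto
    finally show ?thesis .
  qed (auto intro!: Max_ge)
  thus ?thesis using that by blast
qed

lemma at_bot_eventually_less:
  fixes f :: "nat \<Rightarrow> real"
  assumes "filterlim f at_bot sequentially"
  obtains N where "\<And>n. n \<ge> N \<Longrightarrow> f n < C"
  using assms unfolding filterlim_at_bot_dense eventually_sequentially by blast

text \<open>Cutting an interval at \<open>m\<close> splits its gain into two one-sided sums. One is
  bounded above by a constant; the other falls below minus that constant once the interval is long
  on its side. The total is then negative and \<open>free_inf_meets_interval\<close>
  applies.\<close>

lemma free_inf_both_sides:
  assumes up: "filterlim (\<lambda>n. \<Sum>v=m..<m + int n. gain t \<omega> v) at_bot sequentially"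
    and dn: "filterlim (\<lambda>n. \<Sum>v=m - int n..<m. gain t \<omega> v) at_bot sequentially"
  shows "\<exists>h\<ge>m. h \<in> free_inf \<omega> t" "\<exists>h<m. h \<in> free_inf \<omega> t"
proof -
  have split: "(\<Sum>v=a..b. gain t \<omega> v) = (\<Sum>v=m - int (nat (m - a))..<m. gain t \<omega> v) +
      (\<Sum>v=m..<m + int (nat (b + 1 - m)). gain t \<omega> v)" if "a \<le> m" "b \<ge> m - 1" for a b
  proof -
    have "{a..b} = {a..<m} \<union> {m..<b+1}" using that by auto
    hence "(\<Sum>v=a..b. gain t \<omega> v) = (\<Sum>v=a..<m. gain t \<omega> v) + (\<Sum>v=m..<b+1. gain t \<omega> v)"
      by (simp add: sum.union_disjoint)
    thus ?thesis using that by simp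
  qed
  obtain C where C: "\<And>n. (\<Sum>v=m - int n..<m. gain t \<omega> v) \<le> C" using at_bot_bounded_above[OF dn] by metis
  obtain N where N: "\<And>n. n \<ge> N \<Longrightarrow> (\<Sum>v=m..<m + int n. gain t \<omega> v) < - C"
    using at_bot_eventually_less[OF up] by metis
  have "\<exists>h\<in>{m..m + int N}. h \<in> free_inf \<omega> t"
  proof (rule free_inf_meets_interval)
    fix a b assume "a \<le> m" "m + int N \<le> b"
    thus "(\<Sum>v=a..b. gain t \<omega> v) < 0"
      using C[of "nat (m - a)"] N[of "nat (b + 1 - m)"] split[of a b] by linarith
  qed simp
  thus "\<exists>h\<ge>m. h \<in> free_inf \<omega> t" by auto
  obtain C' where C': "\<And>n. (\<Sum>v=m..<m + int n. gain t \<omega> v) \<le> C'" using at_bot_bounded_above[OF up] by metis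
  obtain N' where N': "\<And>n. n \<ge> N' \<Longrightarrow> (\<Sum>v=m - int n..<m. gain t \<omega> v) < - C'"
    using at_bot_eventually_less[OF dn] by metis
  have "\<exists>h\<in>{m - int N'..m - 1}. h \<in> free_inf \<omega> t"
  proof (rule free_inf_meets_interval)
    fix a b assume "a \<le> m - int N'" "m - 1 \<le> b"
    thus "(\<Sum>v=a..b. gain t \<omega> v) < 0"
      using C'[of "nat (b + 1 - m)"] N'[of "nat (m - a)"] split[of a b] by linarith
  qed simp
  thus "\<exists>h<m. h \<in> free_inf \<omega> t" by auto
qed

text \<open>The balls that start between two free holes all stop between them, in different holes.\<close>

lemma card_free_fin_le:
  assumes clock: "\<And>v. clock \<omega> v < 1" and noties: "\<And>v w. v \<noteq> w \<Longrightarrow> clock \<omega> v \<noteq> clock \<omega> w"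
    and escape: "\<And>v a b. \<exists>n. walk \<omega> v n \<notin> {a..b}"
  shows "\<exists>a b. 0 \<le> a \<and> a \<le> b \<and> b \<le> int L \<and>
    real (card (free_fin {0..<int L} \<omega> 1 \<inter> {0..<int L})) \<le> - (\<Sum>v=a..<b. gain 1 \<omega> v)"
proof -
  define A where "A = {0..<int L}"
  define F where "F = free_fin A \<omega> 1 \<inter> A"
  have fin: "finite A" "finite F" by (auto simp: A_def F_def)
  show ?thesis
  proof (cases "F = {}")
    case True
    thus ?thesis by (intro exI[of _ 0]) (auto simp: F_def A_def)
  next
    case False
    define a where "a = Min F"
    define b where "b = Max F"
    have aF: "a \<in> F" and bF: "b \<in> F" using False fin by (auto simp: a_def b_def)
    have F_ab: "F \<subseteq> {a..b}" using fin by (auto simp: a_def b_def)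
    define bs where "bs = {v\<in>{a..b}. st \<omega> v = Ball \<and> clock \<omega> v < 1}"
    define hs where "hs = {v\<in>{a..b}. st \<omega> v = Hole}"
    \<comment> \<open>By \<open>escape\<close> the walk leaves \<open>{a..b}\<close>, and one step
      before leaving it stands on \<open>a\<close> or \<open>b\<close>. Both are free at all clocks,
      so the ball stops by then, still inside the interval.\<close>
    have stop: "\<exists>x\<in>{a..b}. golf_fin A \<omega> v = Some x" if v: "v \<in> bs" for v
    proof -
      let ?F = "free_fin A \<omega> (clock \<omega> v)"
      have vA: "v \<in> A" and vab: "v \<in> {a..b}" and ball: "st \<omega> v = Ball"
        using v aF bF by (auto simp: bs_def F_def A_def)
      have ab: "a \<in> ?F" "b \<in> ?F"
        using aF bF clock[of v] free_fin_antimono_time[of "clock \<omega> v" 1 A \<omega>] by (auto simp: F_def)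
      define k where "k = (LEAST k. walk \<omega> v k \<notin> {a..b})"
      have k: "walk \<omega> v k \<notin> {a..b}" unfolding k_def by (rule LeastI_ex[OF escape])
      have k_min: "walk \<omega> v i \<in> {a..b}" if "i < k" for i
        using not_less_Least[of i "\<lambda>k. walk \<omega> v k \<notin> {a..b}"] that by (auto simp: k_def)
      have "k \<noteq> 0" using k vab by (intro notI) simp
      then obtain j where j: "k = Suc j" by (cases k) auto
      have "walk \<omega> v j \<in> {a, b}"
        using k k_min[of j] walk_Suc[of \<omega> v j] by (auto simp: j)
      hence ex: "walk \<omega> v j \<in> ?F" using ab by auto
      define n where "n = (LEAST n. walk \<omega> v n \<in> ?F)"
      have n: "walk \<omega> v n \<in> ?F" unfolding n_def using ex by (rule LeastI)
      have "n \<le> j" unfolding n_def using ex by (rule Least_le)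
      hence "walk \<omega> v n \<in> {a..b}" using k_min j by simp
      moreover have "golf_fin A \<omega> v = Some (walk \<omega> v n)"
        using not_less_Least[of _ "\<lambda>n. walk \<omega> v n \<in> ?F"] n ball vA fin(1)
        by (intro golf_finI) (auto simp: n_def)
      ultimately show ?thesis by blast
    qed
    \<comment> \<open>Of two balls with the same target, the one with the larger clock would find
      the hole already filled.\<close>
    have inj: "inj_on (\<lambda>v. the (golf_fin A \<omega> v)) bs"
    proof (rule inj_onI, rule ccontr)
      fix v w assume vw: "v \<in> bs" "w \<in> bs" "the (golf_fin A \<omega> v) = the (golf_fin A \<omega> w)" "v \<noteq> w"
      obtain x where x: "golf_fin A \<omega> v = Some x" "golf_fin A \<omega> w = Some x"
        using stop[OF vw(1)] stop[OF vw(2)] vw(3) by auto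
      have "False" if "clock \<omega> v < clock \<omega> w" "golf_fin A \<omega> v = Some x" "golf_fin A \<omega> w = Some x" for v w
      proof -
        have "x \<in> free_fin A \<omega> (clock \<omega> w)" using golf_finD[OF fin(1) that(3)] by blast
        thus False using that fin by (auto simp: mem_free_fin_iff)
      qed
      thus False using x noties[OF vw(4)] by (metis linorder_neqE)
    qed
    \<comment> \<open>A hole that receives a ball is no longer free at time 1, hence not in
      \<open>F\<close>. So the balls inject into the holes outside \<open>F\<close>, and the excess
      of holes over balls is at least \<open>card F\<close>.\<close>
    have "(\<lambda>v. the (golf_fin A \<omega> v)) ` bs \<subseteq> hs - F"
    proof
      fix x assume "x \<in> (\<lambda>v. the (golf_fin A \<omega> v)) ` bs"
      then obtain v where v: "v \<in> bs" "golf_fin A \<omega> v = Some x" "x \<in> {a..b}"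
        using stop by force
      have "x \<in> free_fin A \<omega> (clock \<omega> v)" using golf_finD[OF fin(1) v(2)] by blast
      thus "x \<in> hs - F" using v clock[of v] fin by (auto simp: hs_def F_def mem_free_fin_iff)
    qed
    moreover have "finite hs" by (rule finite_subset[of _ "{a..b}"]) (auto simp: hs_def)
    ultimately have "card bs \<le> card (hs - F)"
      using inj by (intro card_inj_on_le) auto
    moreover have "F \<subseteq> hs" using F_ab fin by (auto simp: hs_def F_def mem_free_fin_iff)
    hence "card (hs - F) = card hs - card F" "card F \<le> card hs"
      using fin \<open>finite hs\<close> by (auto simp: card_Diff_subset intro!: card_mono)
    ultimately have "real (card F) \<le> - (\<Sum>v=a..b. gain 1 \<omega> v)"
      unfolding sum_gain[OF finite_atLeastAtMost_int] bs_def[symmetric] hs_def[symmetric] by linarith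
    moreover have "{a..b} = {a..<b+1}" by auto
    moreover have "0 \<le> a" "a \<le> b" "b + 1 \<le> int L" using aF bF F_ab by (auto simp: F_def A_def)
    ultimately show ?thesis
      by (intro exI[of _ a] exI[of _ "b+1"]) (auto simp: F_def A_def)
  qed
qed

section \<open>Measurability\<close>

text \<open>Only the sigma-algebra matters here: it is that of \<open>golf_measure\<close>, freed
  from the parameters.\<close>

definition sample_space :: "golf_sample measure" where
  "sample_space = PiM UNIV (\<lambda>_. count_space UNIV \<Otimes>\<^sub>M (borel \<Otimes>\<^sub>M PiM UNIV (\<lambda>_. count_space UNIV)))"

lemma measurable_st [measurable]: "(\<lambda>\<omega>. st \<omega> v) \<in> sample_space \<rightarrow>\<^sub>M count_space UNIV"
  unfolding st_def sample_space_def by measurable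

lemma measurable_clock [measurable]: "(\<lambda>\<omega>. clock \<omega> v) \<in> borel_measurable sample_space"
  unfolding clock_def sample_space_def by measurable

lemma measurable_step [measurable]:
  "(\<lambda>\<omega>. snd (snd (\<omega> v)) i) \<in> sample_space \<rightarrow>\<^sub>M count_space UNIV"
  unfolding sample_space_def by measurable

lemma measurable_walk [measurable]: "(\<lambda>\<omega>. walk \<omega> v n) \<in> sample_space \<rightarrow>\<^sub>M count_space UNIV"
proof (induction n)
  case (Suc n)
  have "(\<lambda>\<omega>. walk \<omega> v (Suc n)) =
    (\<lambda>\<omega>. if snd (snd (\<omega> v)) n then walk \<omega> v n + 1 else walk \<omega> v n - 1)"
    by (auto simp: walk_def fun_eq_iff)
  also have "\<dots> \<in> sample_space \<rightarrow>\<^sub>M count_space UNIV"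
    using measurable_compose[OF Suc, of "\<lambda>x. x + 1"] measurable_compose[OF Suc, of "\<lambda>x. x - 1"]
    by measurable
  finally show ?case .
qed simp

lemma measurable_free_before:
  assumes [measurable]: "\<And>w. (\<lambda>\<omega>. T \<omega> w) \<in> sample_space \<rightarrow>\<^sub>M count_space UNIV"
    "t \<in> borel_measurable sample_space"
  shows "Measurable.pred sample_space (\<lambda>\<omega>. free_before (restr A \<omega>) (T \<omega>) (t \<omega>) h)"
  unfolding free_before_def st_restr_Hole st_restr_Ball clock_restr by measurable

lemma measurable_golf_iter [measurable]:
  "(\<lambda>\<omega>. golf_iter k (restr A \<omega>) v) \<in> sample_space \<rightarrow>\<^sub>M count_space UNIV"
proof (induction k arbitrary: v)
  case 0
  show ?case by (simp add: golf_iter_def)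
next
  case (Suc k)
  let ?P = "\<lambda>\<omega> n. free_before (restr A \<omega>) (golf_iter k (restr A \<omega>)) (clock \<omega> v) (walk \<omega> v n)"
  \<comment> \<open>The tested site is itself random. It takes countably many values, so
    measurability for each fixed site suffices.\<close>
  have [measurable]: "Measurable.pred sample_space (\<lambda>\<omega>. ?P \<omega> n)" for n
    by (rule measurable_compose_countable[OF measurable_free_before[OF Suc.IH]]) measurable
  have [measurable]: "(\<lambda>\<omega>. LEAST n. ?P \<omega> n) \<in> sample_space \<rightarrow>\<^sub>M count_space UNIV"
    by measurable
  have [measurable]: "(\<lambda>\<omega>. walk \<omega> v (LEAST n. ?P \<omega> n)) \<in> sample_space \<rightarrow>\<^sub>M count_space UNIV"
    by (rule measurable_compose_countable[of "\<lambda>n \<omega>. walk \<omega> v n"]) measurable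
  have "(\<lambda>\<omega>. if (v \<in> A \<and> st \<omega> v = Ball) \<and> (\<exists>n. ?P \<omega> n) then Some (walk \<omega> v (LEAST n. ?P \<omega> n)) else None)
    \<in> sample_space \<rightarrow>\<^sub>M count_space UNIV"
    by measurable
  thus ?case
    by (simp only: golf_iter_def funpow.simps o_apply golf_step_def st_restr_Ball clock_restr walk_restr)
qed

lemma measurable_free_fin [measurable]: "Measurable.pred sample_space (\<lambda>\<omega>. h \<in> free_fin A \<omega> t)"
  unfolding free_fin_def mem_Collect_eq golf_fin_def by (rule measurable_free_before) measurable

lemma measurable_free_inf [measurable]: "Measurable.pred sample_space (\<lambda>\<omega>. h \<in> free_inf \<omega> t)"
  unfolding free_inf_eq_boxes INT_iff by measurable

lemma measurable_gain [measurable]: "(\<lambda>\<omega>. gain t \<omega> v) \<in> borel_measurable sample_space"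
  unfolding gain_def by measurable

section \<open>Product measures\<close>

text \<open>Only the marginal on the finite set \<open>J\<close> matters, and there this is Fubini;
  \<open>I\<close> may be infinite.\<close>

lemma nn_integral_PiM_prod:
  assumes M: "\<And>i. prob_space (M i)" and J: "finite J" "J \<subseteq> I"
    and f [measurable]: "\<And>i. f i \<in> borel_measurable (M i)"
  shows "(\<integral>\<^sup>+\<omega>. (\<Prod>j\<in>J. f j (\<omega> j)) \<partial>PiM I M) = (\<Prod>j\<in>J. \<integral>\<^sup>+x. f j x \<partial>M j)"
proof -
  interpret product_prob_space M I
    by (simp add: M product_prob_spaceI)
  have [measurable]: "(\<lambda>\<omega>. restrict \<omega> J) \<in> PiM I M \<rightarrow>\<^sub>M PiM J M"
    using J(2) by (rule measurable_restrict_subset)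
  have "(\<integral>\<^sup>+\<omega>. (\<Prod>j\<in>J. f j (\<omega> j)) \<partial>PiM I M) =
    (\<integral>\<^sup>+\<omega>. (\<Prod>j\<in>J. f j (\<omega> j)) \<partial>distr (PiM I M) (PiM J M) (\<lambda>\<omega>. restrict \<omega> J))"
    by (subst nn_integral_distr) (auto intro!: nn_integral_cong prod.cong)
  also have "\<dots> = (\<Prod>j\<in>J. \<integral>\<^sup>+x. f j x \<partial>M j)"
    using J by (simp add: distr_PiM_restrict_finite product_nn_integral_prod)
  finally show ?thesis .
qed

lemma indep_vars_PiM_coordinates:
  assumes "\<And>i. i \<in> I \<Longrightarrow> prob_space (M i)" "I \<noteq> {}"
  shows "prob_space.indep_vars (PiM I M) M (\<lambda>i \<omega>. \<omega> i) I"
proof -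
  interpret prob_space "PiM I M" using assms(1) by (rule prob_space_PiM)
  have "distr (PiM I M) (PiM I M) (\<lambda>x. \<lambda>i\<in>I. x i) = distr (PiM I M) (PiM I M) (\<lambda>x. x)"
    by (intro distr_cong) (auto simp: space_PiM PiE_def extensional_restrict)
  also have "\<dots> = PiM I (\<lambda>i. distr (PiM I M) (M i) (\<lambda>\<omega>. \<omega> i))"
    using assms(1) by (auto simp: distr_id2 distr_PiM_component intro!: PiM_cong)
  finally show ?thesis
    using assms by (subst indep_vars_iff_distr_eq_PiM') auto
qed

lemma (in prob_space) distr_pair_snd:
  assumes "prob_space N"
  shows "distr (M \<Otimes>\<^sub>M N) N snd = N"
proof (intro measure_eqI)
  interpret N: prob_space N by fact
  fix A assume A: "A \<in> sets (distr (M \<Otimes>\<^sub>M N) N snd)"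
  hence "emeasure (distr (M \<Otimes>\<^sub>M N) N snd) A = emeasure (M \<Otimes>\<^sub>M N) (space M \<times> A)"
    by (auto simp add: emeasure_distr space_pair_measure dest: sets.sets_into_space
        intro!: arg_cong2[where f=emeasure])
  with A show "emeasure (distr (M \<Otimes>\<^sub>M N) N snd) A = emeasure N A"
    by (simp add: N.emeasure_pair_measure_Times emeasure_space_1)
qed simp

lemma AE_pair_fst:
  assumes "prob_space N" "AE x in M. P x"
  shows "AE x in M \<Otimes>\<^sub>M N. P (fst x)"
  by (intro AE_distrD[of fst "M \<Otimes>\<^sub>M N" M P])
     (simp_all only: prob_space.distr_pair_fst[OF assms(1)] assms(2) measurable_fst)

lemma AE_pair_snd:
  assumes "prob_space M" "prob_space N" "AE x in N. P x"
  shows "AE x in M \<Otimes>\<^sub>M N. P (snd x)"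
  by (intro AE_distrD[of snd "M \<Otimes>\<^sub>M N" N P])
     (simp_all only: prob_space.distr_pair_snd[OF assms(1,2)] assms(3) measurable_snd)

section \<open>Long runs in i.i.d. sequences\<close>

text \<open>Cut the sequence into disjoint blocks of length \<open>m\<close>. They are independent,
  and each is constantly \<open>c\<close> with the same positive probability, so the probability
  that the first \<open>J\<close> blocks all fail decays geometrically in \<open>J\<close>.\<close>

lemma AE_iid_run:
  assumes "pmf P c > 0"
  shows "AE s in PiM (UNIV::nat set) (\<lambda>_. measure_pmf P). \<exists>k. \<forall>i<m. s (k + i) = c"
proof -
  let ?M = "PiM (UNIV::nat set) (\<lambda>_. measure_pmf P)"
  interpret prob_space ?M by (intro prob_space_PiM measure_pmf.prob_space_axioms)
  define K where "K j = {j * m..<j * m + m}" for j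
  define Y :: "nat \<Rightarrow> (nat \<Rightarrow> 'a) \<Rightarrow> ennreal"
    where "Y j x = (if \<forall>i\<in>K j. x i = c then 0 else 1)" for j x
  have finK: "finite (K j)" for j by (simp add: K_def)
  have disj: "disjoint_family_on K UNIV"
  proof (unfold disjoint_family_on_def, intro ballI impI)
    fix i j :: nat assume "i \<noteq> j"
    have "K i \<inter> K j = {}" if "i < j" for i j
    proof -
      have "i * m + m \<le> j * m" using that by (metis Suc_leI add.commute mult_Suc mult_le_mono1)
      thus ?thesis by (auto simp: K_def)
    qed
    thus "K i \<inter> K j = {}" using \<open>i \<noteq> j\<close> by (metis Int_commute linorder_neqE_nat)
  qed
  have Ym [measurable]: "Y j \<in> borel_measurable (PiM (K j) (\<lambda>_. measure_pmf P))" for j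
  proof -
    have "Measurable.pred (PiM (K j) (\<lambda>_. measure_pmf P)) (\<lambda>x. x i = c)" if "i \<in> K j" for i
      using measurable_component_singleton[OF that, of "\<lambda>_. measure_pmf P"]
      by (rule measurable_compose) simp
    hence [measurable]: "Measurable.pred (PiM (K j) (\<lambda>_. measure_pmf P)) (\<lambda>x. \<forall>i\<in>K j. x i = c)"
      using finK by (intro pred_intros_finite) auto
    show ?thesis unfolding Y_def by measurable
  qed
  have "indep_vars (\<lambda>_. measure_pmf P) (\<lambda>i s. s i) UNIV"
    by (intro indep_vars_PiM_coordinates measure_pmf.prob_space_axioms) auto
  hence "indep_vars (\<lambda>j. PiM (K j) (\<lambda>_. measure_pmf P)) (\<lambda>j s. restrict (\<lambda>i. s i) (K j)) UNIV"
    by (rule indep_vars_restrict) (use disj in auto)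
  hence "indep_vars (\<lambda>_. borel) (\<lambda>j s. Y j (restrict (\<lambda>i. s i) (K j))) UNIV"
    by (rule indep_vars_compose2) (rule Ym)
  hence ind: "indep_vars (\<lambda>_. borel) (\<lambda>j s. Y j s) UNIV"
    by (simp add: Y_def cong: ball_cong)
  have Ym' [measurable]: "Y j \<in> borel_measurable ?M" for j
    using ind by (auto simp: indep_vars_def)
  define r where "r = pmf P c"
  \<comment> \<open>\<open>Y j\<close> indicates failure of block \<open>j\<close>. Success is
    computed first, since its indicator is a product over coordinates.\<close>
  have Z: "(\<integral>\<^sup>+s. 1 - Y j s \<partial>?M) = ennreal (r ^ m)" for j
  proof -
    have "(\<integral>\<^sup>+s. 1 - Y j s \<partial>?M) = (\<integral>\<^sup>+s. (\<Prod>i\<in>K j. indicator {c} (s i)) \<partial>?M)"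
      using finK by (intro nn_integral_cong) (auto simp: Y_def indicator_def)
    also have "\<dots> = (\<Prod>i\<in>K j. \<integral>\<^sup>+x. indicator {c} x \<partial>measure_pmf P)"
      by (intro nn_integral_PiM_prod measure_pmf.prob_space_axioms finK) auto
    also have "\<dots> = ennreal (r ^ m)"
      by (simp add: emeasure_pmf_single K_def r_def ennreal_power)
    finally show ?thesis .
  qed
  have r: "0 < r ^ m" "r ^ m \<le> 1" using assms by (auto simp: r_def pmf_le_1 power_le_one)
  have EY: "(\<integral>\<^sup>+s. Y j s \<partial>?M) = ennreal (1 - r ^ m)" for j
  proof -
    have "(\<integral>\<^sup>+s. Y j s \<partial>?M) = (\<integral>\<^sup>+s. 1 - (1 - Y j s) \<partial>?M)"
      by (intro nn_integral_cong) (auto simp: Y_def)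
    also have "\<dots> = (\<integral>\<^sup>+s. 1 \<partial>?M) - (\<integral>\<^sup>+s. 1 - Y j s \<partial>?M)"
      by (intro nn_integral_diff) (auto simp: Z)
    also have "\<dots> = ennreal 1 - ennreal (r ^ m)"
      by (simp add: Z emeasure_space_1)
    also have "\<dots> = ennreal (1 - r ^ m)"
      using r by (intro ennreal_minus) auto
    finally show ?thesis .
  qed
  \<comment> \<open>The indicator that all blocks fail, as the infimum of the finite
    products.\<close>
  define Z where "Z s = (INF J. \<Prod>j<J. Y j s)" for s
  have [measurable]: "Z \<in> borel_measurable ?M" unfolding Z_def by measurable
  have "(\<integral>\<^sup>+s. Z s \<partial>?M) \<le> ennreal ((1 - r ^ m) ^ J)" for J
  proof -
    have "(\<integral>\<^sup>+s. Z s \<partial>?M) \<le> (\<integral>\<^sup>+s. (\<Prod>j<J. Y j s) \<partial>?M)"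
      unfolding Z_def by (intro nn_integral_mono INF_lower) auto
    also have "\<dots> = (\<Prod>j<J. \<integral>\<^sup>+s. Y j s \<partial>?M)"
      by (intro indep_vars_nn_integral indep_vars_subset[OF ind]) auto
    also have "\<dots> = ennreal ((1 - r ^ m) ^ J)"
      using r by (simp add: EY ennreal_power)
    finally show ?thesis .
  qed
  moreover have "(\<lambda>J. ennreal ((1 - r ^ m) ^ J)) \<longlonglongrightarrow> ennreal 0"
    using r by (intro tendsto_ennrealI LIMSEQ_power_zero) auto
  ultimately have "(\<integral>\<^sup>+s. Z s \<partial>?M) \<le> ennreal 0"
    by (intro LIMSEQ_le_const) auto
  hence "(\<integral>\<^sup>+s. Z s \<partial>?M) = 0" by simp
  hence "AE s in ?M. Z s = 0" by (simp add: nn_integral_0_iff_AE)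
  thus ?thesis
  proof eventually_elim
    case (elim s)
    show ?case
    proof (rule ccontr)
      assume neg: "\<not> ?case"
      have "Y j s = 1" for j
      proof -
        obtain i where "i < m" "s (j * m + i) \<noteq> c" using neg by blast
        thus ?thesis by (auto simp: Y_def K_def)
      qed
      thus False using elim by (simp add: Z_def)
    qed
  qed
qed

section \<open>The law of a single site\<close>

locale golf =
  fixes rb rh p :: real
  assumes rb: "0 \<le> rb" and rh: "0 \<le> rh" and rb_rh: "rb + rh \<le> 1" and p: "0 \<le> p" "p \<le> 1"
begin

definition site_measure :: "(site \<times> real \<times> (nat \<Rightarrow> bool)) measure" where
  "site_measure = measure_pmf (state_pmf rb rh) \<Otimes>\<^sub>M (uniform_measure lborel {0..1::real}
     \<Otimes>\<^sub>M PiM (UNIV :: nat set) (\<lambda>_. measure_pmf (bernoulli_pmf p)))"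

lemma golf_measure_eq: "golf_measure rb rh p = PiM UNIV (\<lambda>_. site_measure)"
  by (simp add: golf_measure_def site_measure_def)

lemma prob_space_clock: "prob_space (uniform_measure lborel {0..1::real})"
  by (intro prob_space_uniform_measure) auto

lemma prob_space_steps: "prob_space (PiM (UNIV :: nat set) (\<lambda>_. measure_pmf (bernoulli_pmf p)))"
  by (intro prob_space_PiM measure_pmf.prob_space_axioms)

lemma prob_space_site: "prob_space site_measure"
  unfolding site_measure_def
  by (intro prob_space_pair prob_space_clock prob_space_steps measure_pmf.prob_space_axioms)

lemma prob_space_golf: "prob_space (golf_measure rb rh p)"
  unfolding golf_measure_eq by (intro prob_space_PiM prob_space_site)

lemma sets_site [measurable_cong]:
  "sets site_measure = sets (count_space UNIV \<Otimes>\<^sub>M (borel \<Otimes>\<^sub>M PiM UNIV (\<lambda>_. count_space UNIV)))"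
  unfolding site_measure_def by (intro sets_pair_measure_cong sets_PiM_cong) auto

lemma sets_golf [measurable_cong]: "sets (golf_measure rb rh p) = sets sample_space"
  unfolding golf_measure_eq sample_space_def by (intro sets_PiM_cong sets_site) auto

lemma space_golf [simp]: "space (golf_measure rb rh p) = UNIV"
  using sets_eq_imp_space_eq[OF sets_golf] by (simp add: sample_space_def space_PiM space_pair_measure)

lemma AE_golf_site:
  assumes "AE x in site_measure. P x"
  shows "AE \<omega> in golf_measure rb rh p. \<forall>v. P (\<omega> v)"
  unfolding golf_measure_eq AE_all_countable
  by (intro allI AE_PiM_component prob_space_site assms) auto

lemma pmf_state:
  "pmf (state_pmf rb rh) s = (case s of Ball \<Rightarrow> rb | Hole \<Rightarrow> rh | Neutral \<Rightarrow> 1 - rb - rh)"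
proof -
  have UNIV: "(UNIV :: site set) = {Ball, Hole, Neutral}"
    using site.exhaust by auto
  show ?thesis
    unfolding state_pmf_def
  proof (rule pmf_embed_pmf)
    show "0 \<le> (case s of Ball \<Rightarrow> rb | Hole \<Rightarrow> rh | Neutral \<Rightarrow> 1 - rb - rh)" for s
      using rb rh rb_rh by (simp split: site.split)
    show "(\<integral>\<^sup>+s. ennreal (case s of Ball \<Rightarrow> rb | Hole \<Rightarrow> rh | Neutral \<Rightarrow> 1 - rb - rh) \<partial>count_space UNIV) = 1"
      using rb rh rb_rh
      by (simp add: UNIV nn_integral_count_space_finite flip: ennreal_plus)
  qed
qed

lemma nn_integral_state:
  "(\<integral>\<^sup>+s. f s \<partial>measure_pmf (state_pmf rb rh)) =
     f Ball * ennreal rb + f Hole * ennreal rh + f Neutral * ennreal (1 - rb - rh)"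
proof -
  have "(\<integral>\<^sup>+s. f s \<partial>measure_pmf (state_pmf rb rh)) =
      (\<Sum>s\<in>{Ball, Hole, Neutral}. f s * ennreal (pmf (state_pmf rb rh) s))"
    by (intro nn_integral_measure_pmf_support) (auto intro: site.exhaust)
  thus ?thesis by (simp add: pmf_state add_ac)
qed

lemma emeasure_clock_less:
  assumes "0 \<le> s" "s \<le> t" "t \<le> 1"
  shows "emeasure (uniform_measure lborel {0..1::real}) {s..<t} = ennreal (t - s)"
proof -
  have "{0..1} \<inter> {s..<t} = {s..<t}" using assms by auto
  thus ?thesis using assms by (simp add: emeasure_uniform_measure divide_ennreal_def)
qed

lemma AE_uniform: "AE u in uniform_measure lborel {0..1::real}. 0 \<le> u \<and> u < 1"
proof (intro AE_uniform_measureI)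
  show "AE u in lborel. u \<in> {0..1::real} \<longrightarrow> 0 \<le> u \<and> u < 1"
    using AE_lborel_singleton[of 1] by eventually_elim auto
qed auto

lemma AE_clock:
  "AE \<omega> in golf_measure rb rh p. \<forall>v. 0 \<le> clock \<omega> v \<and> clock \<omega> v < 1"
proof -
  have "AE x in site_measure. 0 \<le> fst (snd x) \<and> fst (snd x) < 1"
    unfolding site_measure_def
    by (intro AE_pair_snd[where P="\<lambda>y. 0 \<le> fst y \<and> fst y < 1"] AE_pair_fst[where P="\<lambda>u. 0 \<le> u \<and> u < 1"]
        prob_space_pair prob_space_clock prob_space_steps measure_pmf.prob_space_axioms AE_uniform)
  from AE_golf_site[OF this] show ?thesis unfolding clock_def .
qed

lemma nn_integral_clock_in:
  assumes "0 \<le> s" "s \<le> t" "t \<le> 1"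
  shows "(\<integral>\<^sup>+y. indicator {s..<t} (fst y) \<partial>(uniform_measure lborel {0..1::real}
     \<Otimes>\<^sub>M PiM (UNIV :: nat set) (\<lambda>_. measure_pmf (bernoulli_pmf p)))) = ennreal (t - s)" (is ?A)
    and "(\<integral>\<^sup>+x. indicator {s..<t} (fst (snd x)) \<partial>site_measure) = ennreal (t - s)" (is ?B)
proof -
  interpret S: prob_space "PiM (UNIV :: nat set) (\<lambda>_. measure_pmf (bernoulli_pmf p))"
    by (rule prob_space_steps)
  interpret R: prob_space "uniform_measure lborel {0..1::real} \<Otimes>\<^sub>M PiM (UNIV :: nat set) (\<lambda>_. measure_pmf (bernoulli_pmf p))"
    by (intro prob_space_pair prob_space_clock prob_space_steps)
  show ?A
    by (simp add: S.nn_integral_fst[symmetric] S.emeasure_space_1 emeasure_clock_less[OF assms])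
  thus ?B
    unfolding site_measure_def
    by (simp add: R.nn_integral_fst[symmetric] measure_pmf.emeasure_space_1)
qed

text \<open>Divide \<open>[0,1)\<close> into \<open>n + 1\<close> equal cells. A tie puts both
  clocks into one cell, which has probability at most \<open>(n + 1) * (1 / (n + 1))^2\<close>, and
  this tends to 0.\<close>

lemma AE_no_ties:
  "AE \<omega> in golf_measure rb rh p. \<forall>v w. v \<noteq> w \<longrightarrow> clock \<omega> v \<noteq> clock \<omega> w"
proof -
  let ?G = "golf_measure rb rh p"
  have "AE \<omega> in ?G. clock \<omega> v \<noteq> clock \<omega> w" if vw: "v \<noteq> w" for v w
  proof -
    define N where "N = {\<omega>. 0 \<le> clock \<omega> v \<and> clock \<omega> v < 1 \<and> \<not> clock \<omega> v < clock \<omega> w \<and> \<not> clock \<omega> w < clock \<omega> v}"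
    have Nm: "N \<in> sets ?G"
    proof -
      have "{\<omega>\<in>space ?G. 0 \<le> clock \<omega> v \<and> clock \<omega> v < 1 \<and> \<not> clock \<omega> v < clock \<omega> w \<and> \<not> clock \<omega> w < clock \<omega> v} \<in> sets ?G"
        by measurable
      thus ?thesis by (simp add: N_def)
    qed
    have le: "emeasure ?G N \<le> ennreal (1 / real (Suc n))" for n
    proof -
      define I where "I k = {real k / real (Suc n)..<(real k + 1) / real (Suc n)}" for k
      have "emeasure ?G N = (\<integral>\<^sup>+\<omega>. indicator N \<omega> \<partial>?G)" using Nm by simp
      also have "\<dots> \<le> (\<integral>\<^sup>+\<omega>. (\<Sum>k<Suc n. \<Prod>j\<in>{v,w}. indicator (I k) (fst (snd (\<omega> j)))) \<partial>?G)"
      proof (intro nn_integral_mono)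
        fix \<omega>
        show "indicator N \<omega> \<le> (\<Sum>k<Suc n. \<Prod>j\<in>{v,w}. indicator (I k) (fst (snd (\<omega> j))) :: ennreal)"
        proof (cases "\<omega> \<in> N")
          case True
          define c where "c = clock \<omega> v"
          define k where "k = nat \<lfloor>c * real (Suc n)\<rfloor>"
          have c: "0 \<le> c" "c < 1" "clock \<omega> w = c" using True by (auto simp: N_def c_def)
          have k: "real k \<le> c * real (Suc n)" "c * real (Suc n) < real k + 1"
            using c by (auto simp: k_def)
          have "c * real (Suc n) < real (Suc n)" using c by simp
          hence "k < Suc n" using k by linarith
          moreover have "c \<in> I k" using k by (auto simp: I_def field_simps)
          ultimately have "1 \<le> (\<Sum>k\<in>{k}. \<Prod>j\<in>{v,w}. indicator (I k) (fst (snd (\<omega> j))) :: ennreal)"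
            using vw c by (simp add: clock_def[symmetric] c_def[symmetric])
          also have "\<dots> \<le> (\<Sum>k<Suc n. \<Prod>j\<in>{v,w}. indicator (I k) (fst (snd (\<omega> j))))"
            using \<open>k < Suc n\<close> by (intro sum_mono2) auto
          finally show ?thesis by (simp add: True)
        qed simp
      qed
      also have "\<dots> = (\<Sum>k<Suc n. \<integral>\<^sup>+\<omega>. (\<Prod>j\<in>{v,w}. indicator (I k) (fst (snd (\<omega> j)))) \<partial>?G)"
        unfolding golf_measure_eq I_def by (intro nn_integral_sum) measurable
      also have "\<dots> = (\<Sum>k<Suc n. \<Prod>j\<in>{v,w}. \<integral>\<^sup>+x. indicator (I k) (fst (snd x)) \<partial>site_measure)"
        unfolding golf_measure_eq I_def
        by (intro sum.cong refl nn_integral_PiM_prod prob_space_site) auto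
      also have "\<dots> = (\<Sum>k<Suc n. ennreal (1 / real (Suc n)) * ennreal (1 / real (Suc n)))"
      proof (intro sum.cong refl)
        fix k assume "k \<in> {..<Suc n}"
        hence "(\<integral>\<^sup>+x. indicator (I k) (fst (snd x)) \<partial>site_measure) =
          ennreal ((real k + 1) / real (Suc n) - real k / real (Suc n))"
          unfolding I_def by (intro nn_integral_clock_in) (auto simp: field_simps)
        also have "(real k + 1) / real (Suc n) - real k / real (Suc n) = 1 / real (Suc n)"
          by (simp add: diff_divide_distrib[symmetric])
        finally show "(\<Prod>j\<in>{v,w}. \<integral>\<^sup>+x. indicator (I k) (fst (snd x)) \<partial>site_measure) =
          ennreal (1 / real (Suc n)) * ennreal (1 / real (Suc n))"
          using vw by simp
      qed
      also have "\<dots> = ennreal (1 / real (Suc n))"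
        by (simp add: ennreal_mult[symmetric] ennreal_of_nat_eq_real_of_nat del: of_nat_Suc)
      finally show ?thesis .
    qed
    have "(\<lambda>n. ennreal (1 / real (Suc n))) \<longlonglongrightarrow> ennreal 0"
      by (intro tendsto_ennrealI LIMSEQ_Suc lim_1_over_n)
    hence "emeasure ?G N \<le> ennreal 0" using le by (intro LIMSEQ_le_const) auto
    hence "AE \<omega> in ?G. \<omega> \<notin> N" using Nm by (intro AE_not_in null_setsI) auto
    thus ?thesis using AE_clock by eventually_elim (auto simp: N_def)
  qed
  thus ?thesis by (simp add: AE_all_countable)
qed

text \<open>A long run of equal steps carries the walk out of any interval, whatever its drift. The
  direction \<open>c\<close> is one of positive probability, which covers the deterministic cases of
  \<open>p\<close> as well.\<close>

lemma AE_escape: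
  "AE \<omega> in golf_measure rb rh p. \<forall>v a b. \<exists>n. walk \<omega> v n \<notin> {a..b}"
proof -
  define c where "c \<longleftrightarrow> p > 0"
  have c: "pmf (bernoulli_pmf p) c > 0" using p by (cases "p > 0") (auto simp: c_def)
  have "AE s in PiM (UNIV::nat set) (\<lambda>_. measure_pmf (bernoulli_pmf p)).
      \<forall>m. \<exists>k. \<forall>i<m. s (k + i) = c"
    unfolding AE_all_countable by (intro allI AE_iid_run c)
  hence "AE x in site_measure. \<forall>m. \<exists>k. \<forall>i<m. snd (snd x) (k + i) = c"
    unfolding site_measure_def
    by (intro AE_pair_snd[where P="\<lambda>y. \<forall>m. \<exists>k. \<forall>i<m. snd y (k + i) = c"]
        AE_pair_snd[where P="\<lambda>s. \<forall>m. \<exists>k. \<forall>i<m. s (k + i) = c"]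
        prob_space_pair prob_space_clock prob_space_steps measure_pmf.prob_space_axioms)
  from AE_golf_site[OF this] show ?thesis
  proof eventually_elim
    case (elim \<omega>)
    show ?case
    proof (intro allI)
      fix v a b :: int
      \<comment> \<open>With \<open>m\<close> larger than \<open>b - a\<close>, the start and the
        end of the run cannot both lie in \<open>{a..b}\<close>.\<close>
      define m where "m = nat (b - a) + 1"
      obtain k where k: "\<And>i. i < m \<Longrightarrow> snd (snd (\<omega> v)) (k + i) = c" using elim by blast
      have "walk \<omega> v (k + i) = walk \<omega> v k + (if c then int i else - int i)" if "i \<le> m" for i
        using that by (induction i) (auto simp: walk_def k)
      from this[of m] have "walk \<omega> v k \<notin> {a..b} \<or> walk \<omega> v (k + m) \<notin> {a..b}"
        by (auto simp: m_def split: if_splits)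
      thus "\<exists>n. walk \<omega> v n \<notin> {a..b}" by blast
    qed
  qed
qed

end

section \<open>Exponential moments of the imbalance between balls and holes\<close>

definition site_gain :: "real \<Rightarrow> site \<times> real \<times> (nat \<Rightarrow> bool) \<Rightarrow> real" where
  "site_gain t x = (if fst x = Ball \<and> fst (snd x) < t then 1 else if fst x = Hole then -1 else 0)"

lemma gain_eq_site_gain: "gain t \<omega> v = site_gain t (\<omega> v)"
  by (simp add: gain_def site_gain_def st_def clock_def)

context golf
begin

text \<open>The probability generating function at \<open>z\<close> of the gain of a single site,
  expanded around its value 1 at \<open>z = 1\<close>.\<close>

definition site_mgf :: "real \<Rightarrow> real \<Rightarrow> real" where
  "site_mgf t z = 1 + t * rb * (z - 1) + rh * (1 / z - 1)"

lemma nn_integral_powr_site: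
  assumes t: "0 \<le> t" "t \<le> 1" and z: "z > 0"
  shows "(\<integral>\<^sup>+x. ennreal (z powr site_gain t x) \<partial>site_measure) = ennreal (site_mgf t z)"
proof -
  let ?R = "uniform_measure lborel {0..1::real}
    \<Otimes>\<^sub>M PiM (UNIV :: nat set) (\<lambda>_. measure_pmf (bernoulli_pmf p))"
  interpret R: prob_space ?R
    by (intro prob_space_pair prob_space_clock prob_space_steps)
  have [measurable]: "(\<lambda>x. site_gain t x) \<in> borel_measurable (measure_pmf (state_pmf rb rh) \<Otimes>\<^sub>M ?R)"
    unfolding site_gain_def by measurable
  have "AE u in uniform_measure lborel {0..1::real}. 0 \<le> u \<and> u < 1"
    by (rule AE_uniform)
  hence "AE y in ?R. 0 \<le> fst y \<and> fst y < 1"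
    by (intro AE_pair_fst[where P="\<lambda>u. 0 \<le> u \<and> u < 1"] prob_space_steps)
  hence "(\<integral>\<^sup>+y. ennreal (z powr site_gain t (Ball, y)) \<partial>?R) =
    (\<integral>\<^sup>+y. ennreal z * indicator {0..<t} (fst y) + indicator {t..<1} (fst y) \<partial>?R)"
  proof (rule nn_integral_cong_AE[OF AE_mp[OF _ AE_I2]])
    fix y :: "real \<times> (nat \<Rightarrow> bool)"
    show "0 \<le> fst y \<and> fst y < 1 \<longrightarrow> ennreal (z powr site_gain t (Ball, y)) =
        ennreal z * indicator {0..<t} (fst y) + indicator {t..<1} (fst y)"
      using z by (auto simp: site_gain_def)
  qed
  also have "\<dots> = ennreal z * ennreal t + ennreal (1 - t)"
    using t nn_integral_clock_in(1)[of 0 t] nn_integral_clock_in(1)[of t 1]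
    by (simp add: nn_integral_add nn_integral_cmult)
  finally have ball: "(\<integral>\<^sup>+y. ennreal (z powr site_gain t (Ball, y)) \<partial>?R) =
    ennreal (z * t + (1 - t))"
    using t z by (simp add: ennreal_mult ennreal_plus)
  have "(\<integral>\<^sup>+x. ennreal (z powr site_gain t x) \<partial>site_measure) =
    (\<integral>\<^sup>+s. \<integral>\<^sup>+y. ennreal (z powr site_gain t (s, y)) \<partial>?R \<partial>measure_pmf (state_pmf rb rh))"
    unfolding site_measure_def by (subst R.nn_integral_fst[symmetric]) auto
  also have "\<dots> = ennreal (z * t + (1 - t)) * ennreal rb + ennreal (1 / z) * ennreal rh + ennreal (1 - rb - rh)"
    using z R.emeasure_space_1 unfolding nn_integral_state ball
    by (simp add: site_gain_def powr_minus_divide)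
  also have "\<dots> = ennreal ((z * t + (1 - t)) * rb + (1 / z) * rh + (1 - rb - rh))"
  proof -
    have "0 \<le> z * t + (1 - t)" using t z by simp
    thus ?thesis
      using z rb rh rb_rh
      by (simp add: ennreal_mult[symmetric] ennreal_plus[symmetric] del: ennreal_plus)
  qed
  also have "(z * t + (1 - t)) * rb + (1 / z) * rh + (1 - rb - rh) = site_mgf t z"
    by (simp add: site_mgf_def algebra_simps)
  finally show ?thesis .
qed

lemma nn_integral_powr_gain:
  assumes t: "0 \<le> t" "t \<le> 1" and z: "z > 0" and I: "finite I"
  shows "(\<integral>\<^sup>+\<omega>. ennreal (z powr (\<Sum>v\<in>I. gain t \<omega> v)) \<partial>golf_measure rb rh p) =
    ennreal (site_mgf t z) ^ card I"
proof -
  have "(\<integral>\<^sup>+\<omega>. ennreal (z powr (\<Sum>v\<in>I. gain t \<omega> v)) \<partial>golf_measure rb rh p) =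
    (\<integral>\<^sup>+\<omega>. (\<Prod>v\<in>I. ennreal (z powr site_gain t (\<omega> v))) \<partial>golf_measure rb rh p)"
    using z by (intro nn_integral_cong)
      (simp add: powr_sum prod_ennreal gain_eq_site_gain)
  also have "\<dots> = (\<Prod>v\<in>I. \<integral>\<^sup>+x. ennreal (z powr site_gain t x) \<partial>site_measure)"
    unfolding golf_measure_eq
  proof (intro nn_integral_PiM_prod prob_space_site I)
    show "(\<lambda>x. ennreal (z powr site_gain t x)) \<in> borel_measurable site_measure" for i
      unfolding site_gain_def by measurable
  qed auto
  finally show ?thesis by (simp add: nn_integral_powr_site[OF t z])
qed

text \<open>The expectations of \<open>z\<close> to the power of the sums form a convergent
  geometric series. Hence the random series converges almost surely and its terms tend to 0, which
  for \<open>z > 1\<close> sends the exponents to minus infinity. Only the sizes of the sets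
  \<open>I n\<close> enter, so both directions are covered.\<close>

lemma AE_gain_at_bot:
  assumes t: "0 \<le> t" "t \<le> 1" and z: "z > 1" and lt: "0 \<le> site_mgf t z" "site_mgf t z < 1"
    and I: "\<And>n. finite (I n)" "\<And>n. card (I n) = n"
  shows "AE \<omega> in golf_measure rb rh p. filterlim (\<lambda>n. \<Sum>v\<in>I n. gain t \<omega> v) at_bot sequentially"
proof -
  let ?G = "golf_measure rb rh p"
  have "(\<integral>\<^sup>+\<omega>. (\<Sum>n. ennreal (z powr (\<Sum>v\<in>I n. gain t \<omega> v))) \<partial>?G) =
    (\<Sum>n. \<integral>\<^sup>+\<omega>. ennreal (z powr (\<Sum>v\<in>I n. gain t \<omega> v)) \<partial>?G)"
    by (intro nn_integral_suminf) measurable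
  also have "\<dots> = (\<Sum>n. ennreal (site_mgf t z ^ n))"
    using t z lt I by (simp add: nn_integral_powr_gain ennreal_power)
  also have "\<dots> = ennreal (\<Sum>n. site_mgf t z ^ n)"
    using lt by (intro suminf_ennreal2 summable_geometric) auto
  finally have "(\<integral>\<^sup>+\<omega>. (\<Sum>n. ennreal (z powr (\<Sum>v\<in>I n. gain t \<omega> v))) \<partial>?G) \<noteq> \<infinity>"
    by simp
  hence "AE \<omega> in ?G. (\<Sum>n. ennreal (z powr (\<Sum>v\<in>I n. gain t \<omega> v))) \<noteq> \<infinity>"
    by (intro nn_integral_PInf_AE) measurable
  thus ?thesis
  proof eventually_elim
    case (elim \<omega>)
    have "summable (\<lambda>n. z powr (\<Sum>v\<in>I n. gain t \<omega> v))"
      using elim by (intro summable_suminf_not_top) auto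
    hence lim: "(\<lambda>n. z powr (\<Sum>v\<in>I n. gain t \<omega> v)) \<longlonglongrightarrow> 0"
      by (rule summable_LIMSEQ_zero)
    show ?case
      unfolding filterlim_at_bot
    proof
      fix C :: real
      have "0 < z powr C" using z by simp
      from order_tendstoD(2)[OF lim this]
      show "eventually (\<lambda>n. (\<Sum>v\<in>I n. gain t \<omega> v) \<le> C) sequentially"
        by eventually_elim (use z in \<open>simp add: powr_less_cancel_iff less_imp_le\<close>)
    qed
  qed
qed

end

section \<open>The process is almost surely well defined\<close>

locale critical_golf = golf +
  assumes rb_eq: "rb = rh"
begin

lemma AE_free_inf_both_sides:
  assumes t: "0 \<le> t" "t < 1" and pos: "rh > 0"
  shows "AE \<omega> in golf_measure rb rh p. \<forall>m. (\<exists>h<m. h \<in> free_inf \<omega> t) \<and> (\<exists>h>m. h \<in> free_inf \<omega> t)"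
proof -
  let ?G = "golf_measure rb rh p"
  \<comment> \<open>For equal densities
    \<open>site_mgf t z - 1 = rh * (z - 1) * (t - 1 / z)\<close>, which is negative when
    \<open>1 / z\<close> lies strictly between \<open>t\<close> and 1. The midpoint is
    chosen.\<close>
  define z where "z = 2 / (1 + t)"
  have z: "z > 1" using t by (simp add: z_def field_simps)
  have "site_mgf t z = 1 + rh * ((z - 1) * (t - 1 / z))"
    unfolding site_mgf_def unfolding rb_eq using z by (simp add: field_simps)
  also have "t - 1 / z = (t - 1) / 2" using t by (simp add: z_def field_simps)
  finally have eq: "site_mgf t z = 1 - rh * ((z - 1) * ((1 - t) / 2))" by (simp add: field_simps)
  have "0 < rh * ((z - 1) * ((1 - t) / 2))" using pos z t by simp
  moreover have "rh * ((z - 1) * ((1 - t) / 2)) \<le> 1"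
  proof -
    have "z \<le> 2" using t by (simp add: z_def field_simps)
    hence "(z - 1) * ((1 - t) / 2) \<le> 1 * 1" using z t by (intro mult_mono) auto
    hence "rh * ((z - 1) * ((1 - t) / 2)) \<le> 1 * 1"
      using rh rb rb_rh z t by (intro mult_mono) auto
    thus ?thesis by simp
  qed
  ultimately have mgf: "0 \<le> site_mgf t z" "site_mgf t z < 1" by (simp_all add: eq)
  have lim: "AE \<omega> in ?G. filterlim (\<lambda>n. \<Sum>v\<in>I n. gain t \<omega> v) at_bot sequentially"
    if "\<And>n. finite (I n)" "\<And>n. card (I n) = n" for I
    using that t z mgf by (intro AE_gain_at_bot) auto
  have "AE \<omega> in ?G. \<forall>m. filterlim (\<lambda>n. \<Sum>v=m..<m + int n. gain t \<omega> v) at_bot sequentially"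
    unfolding AE_all_countable by (intro allI lim) auto
  moreover have "AE \<omega> in ?G. \<forall>m. filterlim (\<lambda>n. \<Sum>v=m - int n..<m. gain t \<omega> v) at_bot sequentially"
    unfolding AE_all_countable by (intro allI lim) auto
  ultimately show ?thesis
  proof eventually_elim
    case (elim \<omega>)
    show ?case
    proof
      fix m
      have "\<exists>h<m. h \<in> free_inf \<omega> t" "\<exists>h\<ge>m + 1. h \<in> free_inf \<omega> t"
        using elim free_inf_both_sides[of t \<omega>] by blast+
      thus "(\<exists>h<m. h \<in> free_inf \<omega> t) \<and> (\<exists>h>m. h \<in> free_inf \<omega> t)"
        by (metis zless_add1_eq less_le_trans zle_add1_eq_le less_add_one)
    qed
  qed
qed

lemma AE_golf_consistent_exists: "AE \<omega> in golf_measure rb rh p. \<exists>T. golf_consistent \<omega> T"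
proof -
  let ?G = "golf_measure rb rh p"
  \<comment> \<open>Countably many times tending to 1 suffice, because \<open>free_inf\<close>
    decreases in time.\<close>
  define \<tau> where "\<tau> k = 1 - 1 / real (Suc k)" for k
  have \<tau>: "0 \<le> \<tau> k" "\<tau> k < 1" for k by (auto simp: \<tau>_def field_simps)
  have "AE \<omega> in ?G. \<forall>k h. st \<omega> h = Hole \<longrightarrow>
    (\<exists>a<h. a \<in> free_inf \<omega> (\<tau> k)) \<and> (\<exists>b>h. b \<in> free_inf \<omega> (\<tau> k))"
  proof (cases "rh > 0")
    case True
    have "AE \<omega> in ?G. \<forall>k m. (\<exists>h<m. h \<in> free_inf \<omega> (\<tau> k)) \<and> (\<exists>h>m. h \<in> free_inf \<omega> (\<tau> k))"
      unfolding AE_all_countable[where 'i=nat] by (intro allI AE_free_inf_both_sides \<tau> True)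
    thus ?thesis by eventually_elim blast
  next
    case False
    \<comment> \<open>Density 0 means that there are almost surely no holes, so the condition is
      vacuous.\<close>
    hence "AE s in measure_pmf (state_pmf rb rh). s \<noteq> Hole"
      using rh pmf_state[of Hole] by (intro AE_pmfI) (metis antisym_conv2 set_pmf_iff site.case(2))
    hence "AE x in site_measure. fst x \<noteq> Hole"
      unfolding site_measure_def
      by (intro AE_pair_fst[where P="\<lambda>s. s \<noteq> Hole"] prob_space_pair prob_space_clock prob_space_steps)
    from AE_golf_site[OF this] show ?thesis by eventually_elim (simp add: st_def)
  qed
  with AE_clock show ?thesis
  proof eventually_elim
    case (elim \<omega>)
    show ?case
    proof (rule golf_consistent_exists)
      show "clock \<omega> v < 1" for v using elim by blast
      fix s :: real and h assume s: "s < 1" and h: "st \<omega> h = Hole"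
      obtain k where "inverse (real (Suc k)) < 1 - s"
        using reals_Archimedean[of "1 - s"] s by auto
      hence "s \<le> \<tau> k" by (simp add: \<tau>_def inverse_eq_divide)
      hence "free_inf \<omega> (\<tau> k) \<subseteq> free_inf \<omega> s"
        by (rule free_inf_antimono_time)
      moreover obtain a b where "a < h" "a \<in> free_inf \<omega> (\<tau> k)" "b > h" "b \<in> free_inf \<omega> (\<tau> k)"
        using elim(2) h by metis
      ultimately show "(\<exists>a<h. a \<in> free_inf \<omega> s) \<and> (\<exists>b>h. b \<in> free_inf \<omega> s)" by auto
    qed
  qed
qed

end

section \<open>Translation invariance\<close>

definition shift :: "int \<Rightarrow> golf_sample \<Rightarrow> golf_sample" where
  "shift x \<omega> = (\<lambda>v. \<omega> (v + x))"

lemma st_shift [simp]: "st (shift x \<omega>) v = st \<omega> (v + x)"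
  by (simp add: st_def shift_def)

lemma clock_shift [simp]: "clock (shift x \<omega>) v = clock \<omega> (v + x)"
  by (simp add: clock_def shift_def)

lemma walk_shift [simp]: "walk (shift x \<omega>) v n = walk \<omega> (v + x) n - x"
  by (simp add: walk_def shift_def)

lemma restr_shift: "restr ((\<lambda>v. v - x) ` A) (shift x \<omega>) = shift x (restr A \<omega>)"
proof -
  have "v \<in> (\<lambda>v. v - x) ` A \<longleftrightarrow> v + x \<in> A" for v by force
  thus ?thesis by (simp add: restr_def shift_def st_def)
qed

lemma free_before_shift:
  "free_before (shift x \<omega>) (\<lambda>v. map_option (\<lambda>h. h - x) (T (v + x))) t h \<longleftrightarrow> free_before \<omega> T t (h + x)"
proof -
  have eq: "map_option (\<lambda>h. h - x) y = Some h \<longleftrightarrow> y = Some (h + x)" for y by (cases y) auto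
  have "(\<exists>w. P (w + x)) \<longleftrightarrow> (\<exists>w. P w)" for P :: "int \<Rightarrow> bool"
    by (metis diff_add_cancel)
  from this[of "\<lambda>w. st \<omega> w = Ball \<and> clock \<omega> w < t \<and> T w = Some (h + x)"] show ?thesis
    unfolding free_before_def st_shift clock_shift eq by simp
qed

lemma golf_consistent_shift:
  assumes "golf_consistent \<omega> T"
  shows "golf_consistent (shift x \<omega>) (\<lambda>v. map_option (\<lambda>h. h - x) (T (v + x)))"
  unfolding golf_consistent_iff_step
proof
  fix v
  have "T (v + x) = golf_step \<omega> T (v + x)"
    using assms by (simp add: golf_consistent_iff_step)
  thus "map_option (\<lambda>h. h - x) (T (v + x)) =
      golf_step (shift x \<omega>) (\<lambda>v. map_option (\<lambda>h. h - x) (T (v + x))) v"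
    unfolding golf_step_def st_shift clock_shift walk_shift free_before_shift diff_add_cancel by simp
qed

text \<open>The translate of \<open>golf_fin A \<omega>\<close> and \<open>golf_fin\<close> of the
  translated system are both consistent for the same finite system. By
  \<open>free_before_restr_mono\<close> with equal sets, a hole free under one is free under the
  other.\<close>

lemma free_inf_shift_imp:
  assumes "h \<in> free_inf (shift x \<omega>) t"
  shows "h + x \<in> free_inf \<omega> t"
proof -
  have "h + x \<in> free_fin A \<omega> t" if fin: "finite A" for A
  proof -
    let ?A = "(\<lambda>v. v - x) ` A"
    have "h \<in> free_fin ?A (shift x \<omega>) t" using assms fin by (auto simp: free_inf_def)
    hence "free_before (restr ?A (shift x \<omega>)) (golf_fin ?A (shift x \<omega>)) t h"
      by (simp add: free_fin_def)
    moreover have "golf_consistent (restr ?A (shift x \<omega>)) (\<lambda>v. map_option (\<lambda>h. h - x) (golf_fin A \<omega> (v + x)))"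
      unfolding restr_shift by (intro golf_consistent_shift golf_fin_consistent fin)
    moreover have "golf_consistent (restr ?A (shift x \<omega>)) (golf_fin ?A (shift x \<omega>))"
      using fin by (intro golf_fin_consistent) simp
    ultimately have "free_before (restr ?A (shift x \<omega>)) (\<lambda>v. map_option (\<lambda>h. h - x) (golf_fin A \<omega> (v + x))) t h"
      using free_before_restr_mono fin by blast
    thus ?thesis by (simp add: restr_shift free_before_shift free_fin_def)
  qed
  thus ?thesis by (simp add: free_inf_def)
qed

lemma free_inf_shift: "h \<in> free_inf (shift x \<omega>) t \<longleftrightarrow> h + x \<in> free_inf \<omega> t"
proof
  assume "h + x \<in> free_inf \<omega> t"
  moreover have "shift (-x) (shift x \<omega>) = \<omega>" by (simp add: shift_def)
  ultimately show "h \<in> free_inf (shift x \<omega>) t"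
    using free_inf_shift_imp[of "h + x" "-x" "shift x \<omega>" t] by simp
qed (rule free_inf_shift_imp)

context golf
begin

lemma distr_shift: "distr (golf_measure rb rh p) (golf_measure rb rh p) (shift x) = golf_measure rb rh p"
  using distr_PiM_reindex[of UNIV "\<lambda>_. site_measure" "\<lambda>v. v + x" UNIV] prob_space_site
  by (simp add: golf_measure_eq shift_def[abs_def] restrict_UNIV inj_on_def)

lemma measurable_shift [measurable]: "shift x \<in> golf_measure rb rh p \<rightarrow>\<^sub>M golf_measure rb rh p"
  unfolding shift_def golf_measure_eq
  by (rule measurable_PiM_single') (auto simp: space_PiM intro: measurable_component_singleton)

lemma sets_free_inf: "{\<omega>. h \<in> free_inf \<omega> t} \<in> sets (golf_measure rb rh p)"
proof -
  have "{\<omega>\<in>space (golf_measure rb rh p). h \<in> free_inf \<omega> t} \<in> sets (golf_measure rb rh p)"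
    by measurable
  thus ?thesis by simp
qed

lemma sets_free_fin: "{\<omega>. h \<in> free_fin A \<omega> t} \<in> sets (golf_measure rb rh p)"
proof -
  have "{\<omega>\<in>space (golf_measure rb rh p). h \<in> free_fin A \<omega> t} \<in> sets (golf_measure rb rh p)"
    by measurable
  thus ?thesis by simp
qed

lemma emeasure_free_inf_shift:
  "emeasure (golf_measure rb rh p) {\<omega>. h \<in> free_inf \<omega> t} =
   emeasure (golf_measure rb rh p) {\<omega>. 0 \<in> free_inf \<omega> t}"
proof -
  have "emeasure (golf_measure rb rh p) {\<omega>. 0 \<in> free_inf \<omega> t} =
    emeasure (distr (golf_measure rb rh p) (golf_measure rb rh p) (shift h)) {\<omega>. 0 \<in> free_inf \<omega> t}"
    by (simp add: distr_shift)
  also have "\<dots> = emeasure (golf_measure rb rh p) {\<omega>. h \<in> free_inf \<omega> t}"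
    by (subst emeasure_distr) (auto simp: sets_free_inf free_inf_shift vimage_def)
  finally show ?thesis by simp
qed

end

section \<open>No hole stays free\<close>

context critical_golf
begin

text \<open>The interval supplied by \<open>card_free_fin_le\<close> depends on the sample. Summing
  over all pairs of end points replaces it by deterministic intervals, whose exponential moments are
  known.\<close>

lemma AE_powr_card_free_fin_le:
  assumes z: "z > 1"
  shows "AE \<omega> in golf_measure rb rh p.
    ennreal (z powr real (card (free_fin {0..<int L} \<omega> 1 \<inter> {0..<int L}))) \<le>
    (\<Sum>(a,b)\<in>{0..L} \<times> {0..L}. ennreal ((1 / z) powr (\<Sum>v=int a..<int b. gain 1 \<omega> v)))"
  using AE_clock AE_no_ties AE_escape
proof eventually_elim
  case (elim \<omega>)
  obtain a b where ab: "0 \<le> a" "a \<le> b" "b \<le> int L"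
    "real (card (free_fin {0..<int L} \<omega> 1 \<inter> {0..<int L})) \<le> - (\<Sum>v=a..<b. gain 1 \<omega> v)"
    using card_free_fin_le[of \<omega> L] elim by blast
  have "z powr real (card (free_fin {0..<int L} \<omega> 1 \<inter> {0..<int L})) \<le> z powr - (\<Sum>v=a..<b. gain 1 \<omega> v)"
    using ab(4) z by (intro powr_mono) auto
  also have "\<dots> = (1 / z) powr (\<Sum>v=int (nat a)..<int (nat b). gain 1 \<omega> v)"
    using z ab by (simp add: powr_minus powr_divide divide_simps)
  finally have "ennreal (z powr real (card (free_fin {0..<int L} \<omega> 1 \<inter> {0..<int L}))) \<le>
    ennreal ((1 / z) powr (\<Sum>v=int (nat a)..<int (nat b). gain 1 \<omega> v))"
    by (rule ennreal_leI)
  also have "\<dots> = (\<Sum>(a,b)\<in>{(nat a, nat b)}. ennreal ((1 / z) powr (\<Sum>v=int a..<int b. gain 1 \<omega> v)))"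
    by simp
  also have "\<dots> \<le> (\<Sum>(a,b)\<in>{0..L} \<times> {0..L}. ennreal ((1 / z) powr (\<Sum>v=int a..<int b. gain 1 \<omega> v)))"
    using ab by (intro sum_mono2) auto
  finally show ?case .
qed

text \<open>With equal densities the drift vanishes, so the deviation from 1 is quadratic in
  \<open>z - 1\<close>. This is where criticality enters the density bound.\<close>

lemma site_mgf_critical: "z > 0 \<Longrightarrow> site_mgf 1 (1 / z) = 1 + rh * (z - 1)\<^sup>2 / z"
  unfolding site_mgf_def unfolding rb_eq by (simp add: field_simps power2_eq_square)

lemma nn_integral_powr_card_free_fin_le:
  assumes z: "z > 1"
  shows "(\<integral>\<^sup>+\<omega>. ennreal (z powr real (card (free_fin {0..<int L} \<omega> 1 \<inter> {0..<int L}))) \<partial>golf_measure rb rh p) \<le>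
    ennreal ((real L + 1)\<^sup>2 * site_mgf 1 (1 / z) ^ L)"
proof -
  let ?G = "golf_measure rb rh p"
  define \<phi> where "\<phi> = site_mgf 1 (1 / z)"
  have \<phi>: "\<phi> \<ge> 1" using z rh by (simp add: \<phi>_def site_mgf_critical)
  have "(\<integral>\<^sup>+\<omega>. ennreal (z powr real (card (free_fin {0..<int L} \<omega> 1 \<inter> {0..<int L}))) \<partial>?G) \<le>
    (\<integral>\<^sup>+\<omega>. (\<Sum>(a,b)\<in>{0..L} \<times> {0..L}. ennreal ((1 / z) powr (\<Sum>v=int a..<int b. gain 1 \<omega> v))) \<partial>?G)"
    by (rule nn_integral_mono_AE[OF AE_powr_card_free_fin_le[OF z]])
  also have "\<dots> = (\<Sum>(a,b)\<in>{0..L} \<times> {0..L}. \<integral>\<^sup>+\<omega>. ennreal ((1 / z) powr (\<Sum>v=int a..<int b. gain 1 \<omega> v)) \<partial>?G)"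
    unfolding case_prod_beta by (rule nn_integral_sum) measurable
  also have "\<dots> \<le> (\<Sum>(a,b)\<in>{0..L} \<times> {0..L}. ennreal (\<phi> ^ L))"
  proof (intro sum_mono, clarify)
    fix a b assume "a \<in> {0..L}" "b \<in> {0..L}"
    hence "\<phi> ^ (b - a) \<le> \<phi> ^ L" using \<phi> by (intro power_increasing) auto
    \<comment> \<open>Truncated subtraction is right here: for \<open>b < a\<close> the interval is
      empty and the exponent is 0.\<close>
    moreover have "nat (int b - int a) = b - a" by arith
    ultimately show "(\<integral>\<^sup>+\<omega>. ennreal ((1 / z) powr (\<Sum>v=int a..<int b. gain 1 \<omega> v)) \<partial>?G) \<le> ennreal (\<phi> ^ L)"
      using z \<phi> by (simp add: nn_integral_powr_gain \<phi>_def[symmetric] ennreal_power ennreal_leI)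
  qed
  also have "\<dots> = ennreal ((real L + 1)\<^sup>2 * \<phi> ^ L)"
    using \<phi> by (simp add: case_prod_beta ennreal_of_nat_eq_real_of_nat ennreal_mult power2_eq_square algebra_simps)
  finally show ?thesis by (simp add: \<phi>_def)
qed

text \<open>Convexity turns the exponential moment into a bound for the expected number of holes of
  \<open>{0..<L}\<close> that the balls of \<open>{0..<L}\<close> leave free; by monotonicity and translation invariance this
  number is at least \<open>L\<close> times the density of \<open>free_inf\<close>.\<close>

lemma density_free_inf_le:
  assumes z: "z > 1" and L: "L > 0"
  shows "measure (golf_measure rb rh p) {\<omega>. 0 \<in> free_inf \<omega> 1} * ln z \<le>
    2 * ln (real L + 1) / real L + ln (site_mgf 1 (1 / z))"
proof -
  let ?G = "golf_measure rb rh p"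
  interpret prob_space ?G by (rule prob_space_golf)
  have total: "emeasure ?G UNIV = 1" using emeasure_space_1 by simp
  define q where "q = measure ?G {\<omega>. 0 \<in> free_inf \<omega> 1}"
  define A where "A = {0..<int L}"
  define X where "X \<omega> = real (card (free_fin A \<omega> 1 \<inter> A))" for \<omega>
  define \<phi> where "\<phi> = site_mgf 1 (1 / z)"
  define K where "K = (real L + 1)\<^sup>2 * \<phi> ^ L"
  have \<phi>: "\<phi> \<ge> 1" using z rh by (simp add: \<phi>_def site_mgf_critical)
  have "1 * 1 \<le> K"
    unfolding K_def using \<phi> by (intro mult_mono one_le_power) (auto simp: one_le_power)
  hence K: "K \<ge> 1" by simp
  have X_eq: "ennreal (X \<omega>) = (\<Sum>x\<in>A. indicator {\<omega>. x \<in> free_fin A \<omega> 1} \<omega>)" for \<omega>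
  proof -
    have "(\<Sum>x\<in>A. indicator {\<omega>. x \<in> free_fin A \<omega> 1} \<omega>) = (\<Sum>x\<in>A. ennreal (indicator (free_fin A \<omega> 1) x))"
      by (intro sum.cong) (auto simp: indicator_def)
    also have "\<dots> = ennreal (\<Sum>x\<in>A. indicator (free_fin A \<omega> 1) x)" by (intro sum_ennreal) auto
    also have "(\<Sum>x\<in>A. indicator (free_fin A \<omega> 1) x) = X \<omega>"
      by (simp add: X_def A_def indicator_def sum.If_cases Int_commute)
    finally show ?thesis by simp
  qed
  have Xm [measurable]: "(\<lambda>\<omega>. ennreal (X \<omega>)) \<in> borel_measurable ?G"
    unfolding X_eq using sets_free_fin by measurable
  have "emeasure ?G {\<omega>. x \<in> free_inf \<omega> 1} = ennreal q" for x
    by (subst emeasure_free_inf_shift) (simp add: q_def emeasure_eq_measure)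
  hence "ennreal (real L * q) = (\<Sum>x\<in>A. emeasure ?G {\<omega>. x \<in> free_inf \<omega> 1})"
    by (simp add: A_def ennreal_mult ennreal_of_nat_eq_real_of_nat q_def)
  also have "\<dots> \<le> (\<Sum>x\<in>A. emeasure ?G {\<omega>. x \<in> free_fin A \<omega> 1})"
    by (intro sum_mono emeasure_mono sets_free_fin) (auto simp: free_inf_def A_def)
  also have "\<dots> = (\<integral>\<^sup>+\<omega>. ennreal (X \<omega>) \<partial>?G)"
    unfolding X_eq using sets_free_fin by (subst nn_integral_sum) auto
  finally have EX: "ennreal (real L * q) \<le> (\<integral>\<^sup>+\<omega>. ennreal (X \<omega>) \<partial>?G)" .
  \<comment> \<open>The inequality \<open>1 + x \<le> exp x\<close> at
    \<open>x = ln z * X \<omega> - ln K\<close> takes the place of Jensen. After integration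
    \<open>z powr X \<omega> / K\<close> contributes at most 1, which cancels against the 1 on the
    left; \<open>K \<ge> 1\<close> keeps \<open>ln K\<close> nonnegative, as \<open>ennreal\<close>
    requires.\<close>
  have "ln z * X \<omega> + 1 \<le> ln K + z powr X \<omega> / K" for \<omega>
    using exp_ge_add_one_self[of "ln z * X \<omega> - ln K"] z K
    by (simp add: exp_diff powr_def mult.commute)
  hence "ennreal (ln z * X \<omega> + 1) \<le> ennreal (ln K + z powr X \<omega> / K)" for \<omega>
    by (rule ennreal_leI)
  moreover have "ennreal (ln z * X \<omega> + 1) = ennreal (ln z) * ennreal (X \<omega>) + 1" for \<omega>
    using z by (simp add: ennreal_plus ennreal_mult X_def)
  moreover have "ennreal (ln K + z powr X \<omega> / K) = ennreal (ln K) + ennreal (1 / K) * ennreal (z powr X \<omega>)" for \<omega>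
    using K by (simp add: ennreal_plus ennreal_mult[symmetric])
  ultimately have pw: "ennreal (ln z) * ennreal (X \<omega>) + 1 \<le> ennreal (ln K) + ennreal (1 / K) * ennreal (z powr X \<omega>)" for \<omega>
    by metis
  have Zm [measurable]: "(\<lambda>\<omega>. ennreal (z powr X \<omega>)) \<in> borel_measurable ?G"
  proof -
    have "X = (\<lambda>\<omega>. enn2real (ennreal (X \<omega>)))" by (simp add: X_def fun_eq_iff)
    also have "\<dots> \<in> borel_measurable ?G" by measurable
    finally show ?thesis by measurable
  qed
  have "ennreal (ln z) * ennreal (real L * q) + 1 \<le> ennreal (ln z) * (\<integral>\<^sup>+\<omega>. ennreal (X \<omega>) \<partial>?G) + 1"
    by (intro add_mono mult_left_mono EX) auto
  also have "\<dots> = (\<integral>\<^sup>+\<omega>. ennreal (ln z) * ennreal (X \<omega>) + 1 \<partial>?G)"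
    by (simp add: nn_integral_add nn_integral_cmult total)
  also have "\<dots> \<le> (\<integral>\<^sup>+\<omega>. ennreal (ln K) + ennreal (1 / K) * ennreal (z powr X \<omega>) \<partial>?G)"
    by (intro nn_integral_mono pw)
  also have "\<dots> = ennreal (ln K) + ennreal (1 / K) * (\<integral>\<^sup>+\<omega>. ennreal (z powr X \<omega>) \<partial>?G)"
    by (simp add: nn_integral_add nn_integral_cmult[OF Zm] total)
  also have "\<dots> \<le> ennreal (ln K) + ennreal (1 / K) * ennreal K"
    using nn_integral_powr_card_free_fin_le[OF z, of L]
    by (intro add_mono mult_left_mono) (auto simp: X_def A_def K_def \<phi>_def)
  also have "\<dots> = ennreal (ln K + 1)"
    using K by (simp add: ennreal_mult[symmetric] ennreal_plus)
  also have "ennreal (ln z) * ennreal (real L * q) + 1 = ennreal (ln z * (real L * q) + 1)"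
    using z by (simp add: ennreal_plus ennreal_mult q_def)
  finally have "ln z * (real L * q) \<le> ln K" using K z by (simp add: q_def ennreal_le_iff)
  also have "ln K = 2 * ln (real L + 1) + real L * ln \<phi>"
    using \<phi> by (simp add: K_def ln_mult ln_realpow)
  finally show ?thesis using L by (simp add: q_def \<phi>_def field_simps)
qed

text \<open>Letting the box grow removes the logarithmic term, so the density \<open>q\<close>
  satisfies \<open>q * ln z \<le> (z - 1)^2 / z\<close> for all \<open>z > 1\<close>. The left side
  is at least \<open>q * (z - 1) / z\<close>, so \<open>q \<le> z - 1\<close>, and \<open>z\<close>
  may tend to 1.\<close>

lemma density_free_inf_eq_0: "measure (golf_measure rb rh p) {\<omega>. 0 \<in> free_inf \<omega> 1} = 0"
proof -
  define q where "q = measure (golf_measure rb rh p) {\<omega>. 0 \<in> free_inf \<omega> 1}"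
  have "q \<le> z - 1" if z: "z > 1" for z :: real
  proof -
    have "(\<lambda>n. 4 * (ln (real (Suc n)) / real (Suc n)) + ln (site_mgf 1 (1 / z))) \<longlonglongrightarrow>
        4 * 0 + ln (site_mgf 1 (1 / z))"
      by (intro tendsto_intros LIMSEQ_Suc[OF lim_ln_over_n])
    moreover have "q * ln z \<le> 4 * (ln (real (Suc n)) / real (Suc n)) + ln (site_mgf 1 (1 / z))"
      if "n \<ge> 1" for n
    proof -
      \<comment> \<open>The factor 4 absorbs the passage from \<open>1 / n\<close> to
        \<open>1 / (n + 1)\<close>, since \<open>n + 1 \<le> 2 * n\<close>.\<close>
      have "2 * ln (real n + 1) / real n \<le> 4 * (ln (real (Suc n)) / real (Suc n))"
      proof -
        have "2 * ln (real n + 1) * (real n + 1) \<le> 2 * ln (real n + 1) * (2 * real n)"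
          using that by (intro mult_left_mono) auto
        thus ?thesis using that by (simp add: field_simps)
      qed
      thus ?thesis using density_free_inf_le[OF z, of n] that by (simp add: q_def)
    qed
    ultimately have "q * ln z \<le> ln (site_mgf 1 (1 / z))"
      by (intro LIMSEQ_le_const) auto
    also have "\<dots> \<le> rh * (z - 1)\<^sup>2 / z"
      unfolding site_mgf_critical[OF order.strict_trans[OF zero_less_one z]]
      using z rh by (intro ln_add_one_self_le_self) auto
    also have "\<dots> \<le> 1 * (z - 1)\<^sup>2 / z"
      using z rb rb_rh by (intro divide_right_mono mult_right_mono) auto
    finally have "q * ln z \<le> (z - 1)\<^sup>2 / z" by simp
    moreover have "q * ((z - 1) / z) \<le> q * ln z"
    proof (intro mult_left_mono)
      have "ln (1 / z) \<le> 1 / z - 1" using z by (intro ln_le_minus_one) auto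
      thus "(z - 1) / z \<le> ln z" using z by (simp add: ln_div field_simps)
    qed (simp add: q_def)
    ultimately have "q * ((z - 1) / z) \<le> (z - 1)\<^sup>2 / z" by linarith
    hence "q * (z - 1) \<le> (z - 1) * (z - 1)" using z by (simp add: divide_le_cancel power2_eq_square)
    thus ?thesis using z by simp
  qed
  hence "q \<le> 0 + e" if "e > 0" for e using that by (metis add_0 add_diff_cancel_left' less_add_same_cancel1)
  hence "q \<le> 0" by (rule field_le_epsilon)
  thus ?thesis by (simp add: q_def measure_nonneg antisym)
qed

lemma AE_free_inf_empty: "AE \<omega> in golf_measure rb rh p. free_inf \<omega> 1 = {}"
proof -
  let ?G = "golf_measure rb rh p"
  interpret prob_space ?G by (rule prob_space_golf)
  have "AE \<omega> in ?G. h \<notin> free_inf \<omega> 1" for h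
    using AE_not_in[of "{\<omega>. h \<in> free_inf \<omega> 1}" ?G] sets_free_inf[of h 1]
      emeasure_free_inf_shift[of h 1] density_free_inf_eq_0
    by (simp add: null_sets_def emeasure_eq_measure)
  hence "AE \<omega> in ?G. \<forall>h. h \<notin> free_inf \<omega> 1" by (subst AE_all_countable) simp
  thus ?thesis by eventually_elim auto
qed

end

theorem mainTheorem7:
  fixes rb rh p :: real
  assumes "0 \<le> rb" "0 \<le> rh" "rb + rh \<le> 1" "rb = rh"
    and "0 \<le> p" "p \<le> 1"
  shows "AE \<omega> in golf_measure rb rh p.
           (\<exists>T. golf_consistent \<omega> T) \<and>
           (\<forall>T. golf_consistent \<omega> T \<longrightarrow> free_holes_at \<omega> T 1 = {})"
proof -
  interpret critical_golf rb rh p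
    using assms by unfold_locales
  show ?thesis
    using AE_clock AE_golf_consistent_exists AE_free_inf_empty
  proof eventually_elim
    case (elim \<omega>)
    have "free_holes_at \<omega> T 1 = {}" if "golf_consistent \<omega> T" for T
      using free_holes_at_subset_free_inf[OF that, of 1] elim by (metis less_irrefl subset_empty)
    thus ?case using elim by blast
  qed
qed

end
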